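(* Let $\alpha,\beta>0$ with $\beta\le\frac{1}{20\alpha}$, let $\mathcal{A}:\mathbb{R}^{n_1\times n_2}\to\mathbb{R}^{n_3}$ be linear, let $r$ be a positive integer, and let $X_0\in\mathbb{R}^{n_1\times n_2}$ be a matrix of rank $r$ or less. If $\mathcal{A}$ satisfies the restricted isometry property with $\delta_{2r}(\mathcal{A})\le0.4663$, then, with $b=\mathcal{A}(X_0)$, the model $$\min_{X\in\mathbb{R}^{n_1\times n_2}}\{\|X\|_*+\beta\hat\Phi(X):\mathcal{A}X=b\}$$ exactly recovers $X_0$, i.e. $X_0$ is its unique minimizer.
   Context: Let $m=\min\{n_1,n_2\}$. $\sigma_1(X)\ge\dots\ge\sigma_m(X)\ge0$ are the singular values of $X\in\mathbb{R}^{n_1\times n_2}$, $\|X\|_*=\sum_{i=1}^m\sigma_i(X)$ is the nuclear norm, and $\hat\Phi(X)=\sum_{i=1}^m\varphi(\sigma_i(X))$ with $\varphi(t)=\frac{\alpha|t|}{1+\alpha|t|}$. The rank restricted isometry constant $\delta_r(\mathcal{A})$ is the smallest $\delta\ge0$ such that $(1-\delta)\|X\|_F^2\le\|\mathcal{A}(X)\|_2^2\le(1+\delta)\|X\|_F^2$ for all $X\in\mathbb{R}^{n_1\times n_2}$ of rank at most $r$. *)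

theory Defs
  imports "HOL-Analysis.Analysis"
begin

definition eigenspace :: "real^'n^'n \<Rightarrow> real \<Rightarrow> (real^'n) set" where
  "eigenspace S l = {v. S *v v = l *\<^sub>R v}"

definition min_dim :: "real^'n^'m \<Rightarrow> nat" where
  "min_dim X = min CARD('m) CARD('n)"

definition singular_set :: "real^'n^'m \<Rightarrow> real set" where
  "singular_set X = {s. 0 \<le> s \<and> eigenspace (transpose X ** X) (s\<^sup>2) \<noteq> {0}}"

text \<open>
  The singular values are the square roots of the eigenvalues of \<open>X\<^sup>T X\<close>, in nonincreasing
  order and repeated according to multiplicity. Since \<open>X\<^sup>T X\<close> is symmetric, the multiplicity of
  an eigenvalue is the dimension of its eigenspace. There are \<open>CARD('n)\<close> of these numbers; if
  \<open>CARD('n) > CARD('m)\<close>, then all those after the first \<open>CARD('m)\<close> are zero and they are dropped.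
\<close>

definition singular_value_list :: "real^'n^'m \<Rightarrow> real list" where
  "singular_value_list X =
     take (min_dim X)
       (concat (map (\<lambda>s. replicate (dim (eigenspace (transpose X ** X) (s\<^sup>2))) s)
         (rev (sorted_list_of_set (singular_set X)))))"

text \<open>Indexed from \<open>1\<close> to \<open>min_dim X\<close>; the largest one is \<open>singular_value X 1\<close>.\<close>

definition singular_value :: "real^'n^'m \<Rightarrow> nat \<Rightarrow> real" where
  "singular_value X i = singular_value_list X ! (i - 1)"

definition nuclear_norm :: "real^'n^'m \<Rightarrow> real" where
  "nuclear_norm X = (\<Sum>i=1..min_dim X. singular_value X i)"

definition frac_fun :: "real \<Rightarrow> real \<Rightarrow> real" where
  "frac_fun \<alpha> t = \<alpha> * \<bar>t\<bar> / (1 + \<alpha> * \<bar>t\<bar>)"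

definition frac_penalty :: "real \<Rightarrow> real^'n^'m \<Rightarrow> real" where
  "frac_penalty \<alpha> X = (\<Sum>i=1..min_dim X. frac_fun \<alpha> (singular_value X i))"

text \<open>The norm of the type \<open>real^'n^'m\<close> is the Frobenius norm.\<close>

definition rip_bound :: "(real^'n^'m \<Rightarrow> real^'k) \<Rightarrow> nat \<Rightarrow> real \<Rightarrow> bool" where
  "rip_bound \<A> r \<delta> \<longleftrightarrow> 0 \<le> \<delta> \<and>
     (\<forall>X. rank X \<le> r \<longrightarrow>
        (1 - \<delta>) * (norm X)\<^sup>2 \<le> (norm (\<A> X))\<^sup>2 \<and>
        (norm (\<A> X))\<^sup>2 \<le> (1 + \<delta>) * (norm X)\<^sup>2)"

definition rip_const :: "(real^'n^'m \<Rightarrow> real^'k) \<Rightarrow> nat \<Rightarrow> real" where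
  "rip_const \<A> r = (LEAST \<delta>. rip_bound \<A> r \<delta>)"

lemma frobenius_norm:
  fixes X :: "real^'n^'m"
  shows "norm X = sqrt (\<Sum>i\<in>UNIV. \<Sum>j\<in>UNIV. (X $ i $ j)\<^sup>2)"
  by (simp add: norm_vec_def L2_set_def sum_nonneg)

text \<open>The least constant exists for every linear map.\<close>

lemma rip_bound_rip_const:
  fixes \<A> :: "real^'n^'m \<Rightarrow> real^'k"
  assumes "linear \<A>"
  shows "rip_bound \<A> r (rip_const \<A> r)"
proof -
  let ?S = "{\<delta>. rip_bound \<A> r \<delta>}"
  obtain B where B: "\<And>X. norm (\<A> X) \<le> B * norm X"
    using linear_bounded[OF assms] by blast
  have "rip_bound \<A> r (1 + B\<^sup>2)"
    unfolding rip_bound_def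
  proof (intro conjI allI impI)
    fix X :: "real^'n^'m"
    have "(1 - (1 + B\<^sup>2)) * (norm X)\<^sup>2 \<le> 0" by simp
    then show "(1 - (1 + B\<^sup>2)) * (norm X)\<^sup>2 \<le> (norm (\<A> X))\<^sup>2"
      using zero_le_power2[of "norm (\<A> X)"] by linarith
    have "(norm (\<A> X))\<^sup>2 \<le> (B * norm X)\<^sup>2"
      using B[of X] by (intro power_mono) auto
    then show "(norm (\<A> X))\<^sup>2 \<le> (1 + (1 + B\<^sup>2)) * (norm X)\<^sup>2"
      using zero_le_power2[of "norm X"]
      by (simp add: power_mult_distrib algebra_simps add_increasing)
  qed simp
  then have ne: "?S \<noteq> {}" by blast
  have bdd: "bdd_below ?S" by (rule bdd_belowI[of _ 0]) (simp add: rip_bound_def)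
  have "closed ?S"
    unfolding rip_bound_def
    by (intro closed_Collect_conj closed_Collect_all closed_Collect_imp closed_Collect_le
          open_Collect_const continuous_intros)
  then have "rip_bound \<A> r (Inf ?S)"
    using closed_contains_Inf[OF ne bdd] by simp
  moreover have "rip_const \<A> r = Inf ?S"
    unfolding rip_const_def
    by (rule Least_equality) (use calculation bdd in \<open>auto intro: cInf_lower\<close>)
  ultimately show ?thesis by simp
qed

lemma finite_singular_set:
  fixes X :: "real^'n^'m"
  shows "finite (singular_set X)"
proof -
  let ?S = "transpose X ** X"
  have "0 \<in> eigenspace ?S (s\<^sup>2)" for s
    by (simp add: eigenspace_def)
  then have "\<forall>s\<in>singular_set X. \<exists>v. v \<noteq> 0 \<and> ?S *v v = s\<^sup>2 *\<^sub>R v"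
    unfolding singular_set_def eigenspace_def by blast
  then obtain v where v: "\<And>s. s \<in> singular_set X \<Longrightarrow> v s \<noteq> 0"
      "\<And>s. s \<in> singular_set X \<Longrightarrow> ?S *v v s = s\<^sup>2 *\<^sub>R v s"
    by metis
  have orth: "v s \<bullet> v t = 0"
    if "s \<in> singular_set X" "t \<in> singular_set X" "s \<noteq> t" for s t
  proof -
    have "(?S *v v s) \<bullet> v t = v s \<bullet> (?S *v v t)"
      by (metis dot_lmul_matrix matrix_transpose_mul transpose_transpose
          transpose_matrix_vector)
    then have "s\<^sup>2 * (v s \<bullet> v t) = t\<^sup>2 * (v s \<bullet> v t)"
      using v(2) that by simp
    moreover have "s\<^sup>2 \<noteq> t\<^sup>2"
      using that unfolding singular_set_def by auto
    ultimately show ?thesis by simp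
  qed
  have "independent (v ` singular_set X)"
    using v(1) orth
    by (intro pairwise_orthogonal_independent)
       (auto simp: pairwise_def orthogonal_def)
  then have "finite (v ` singular_set X)"
    using independent_bound by blast
  moreover have "inj_on v (singular_set X)"
    by (rule inj_onI) (metis orth v(1) inner_eq_zero_iff)
  ultimately show ?thesis using finite_imageD by blast
qed

end

theory Submission
  imports Defs
begin

text \<open>
  Let \<open>W = X - X\<^sub>0\<close> lie in the kernel of \<open>\<A>\<close>, let \<open>w\<^sub>1 \<ge> w\<^sub>2 \<ge> \<dots>\<close> be its singular values, and let
  \<open>K = w\<^sub>1 + \<dots> + w\<^sub>r\<close>. Testing the symmetric dilation of \<open>X\<close> on a suitable subspace gives
  \<open>\<parallel>X\<parallel>\<^sub>* \<ge> \<parallel>X\<^sub>0\<parallel>\<^sub>* + \<parallel>W\<parallel>\<^sub>* - 2 K\<close>. The function \<open>h(t) = \<alpha> t - \<phi>(t)\<close> is convex with slope in \<open>[0, \<alpha>]\<close>, so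
  the spectral sum of \<open>h\<close> grows by at most \<open>\<alpha> \<parallel>W\<parallel>\<^sub>*\<close> from \<open>X\<^sub>0\<close> to \<open>X\<close>. If \<open>X\<close> is not worse than \<open>X\<^sub>0\<close>,
  both bounds together give \<open>\<parallel>W\<parallel>\<^sub>* \<le> 2 (1 + \<alpha> \<beta>) K\<close>, hence \<open>\<tau> = 1 + 2 \<alpha> \<beta> \<le> 1.1\<close> bounds the ratio of the
  tail \<open>w\<^sub>r\<^sub>+\<^sub>1 + w\<^sub>r\<^sub>+\<^sub>2 + \<dots>\<close> to \<open>K\<close>. A linear functional on the tails with entries at most \<open>\<tau> K / r\<close> and
  sum at most \<open>\<tau> K\<close> is largest at an \<open>r\<close>-sparse tail, where the restricted isometry property for
  rank \<open>2 r\<close> bounds the correlation with the head of \<open>W\<close>. This gives \<open>1 - \<delta> \<le> \<tau> \<delta>\<close> unless \<open>W = 0\<close>, and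
  \<open>1 / (1 + 1.1) > 0.4663\<close>.
\<close>

subsection \<open>Orthonormal families\<close>

text \<open>Indexed families instead of sets: the left and right singular vectors are then two
  families \<open>p\<close> and \<open>id\<close> over one index set.\<close>

definition orthonormal_on :: "'i set \<Rightarrow> ('i \<Rightarrow> 'a::real_inner) \<Rightarrow> bool" where
  "orthonormal_on I f \<longleftrightarrow> (\<forall>i\<in>I. \<forall>j\<in>I. f i \<bullet> f j = (if i = j then 1 else 0))"

lemma orthonormal_onD:
  "orthonormal_on I f \<Longrightarrow> i \<in> I \<Longrightarrow> j \<in> I \<Longrightarrow> f i \<bullet> f j = (if i = j then 1 else 0)"
  by (simp add: orthonormal_on_def)

lemma orthonormal_on_subset: "orthonormal_on I f \<Longrightarrow> J \<subseteq> I \<Longrightarrow> orthonormal_on J f"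
  by (simp add: orthonormal_on_def subset_iff)

lemma inner_sum_orthonormal:
  assumes "finite I" "orthonormal_on I f" "J \<subseteq> I" "i \<in> I"
  shows "(\<Sum>j\<in>J. c j *\<^sub>R f j) \<bullet> f i = (if i \<in> J then c i else 0)"
proof -
  have "(\<Sum>j\<in>J. c j *\<^sub>R f j) \<bullet> f i = (\<Sum>j\<in>J. if j = i then c j else 0)"
    unfolding inner_sum_left
    by (intro sum.cong) (use assms in \<open>auto simp: orthonormal_onD subset_iff\<close>)
  then show ?thesis
    using assms finite_subset[of J I] by simp
qed

lemma orthonormal_expansion:
  assumes "finite I" "orthonormal_on I f" "x \<in> span (f ` I)"
  shows "x = (\<Sum>i\<in>I. (x \<bullet> f i) *\<^sub>R f i)"
  using assms(3)
proof (induction rule: span_induct)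
  case base
  show ?case
    unfolding subspace_def
    proof (intro conjI allI ballI impI; clarsimp)
    fix a b assume a: "a = (\<Sum>i\<in>I. (a \<bullet> f i) *\<^sub>R f i)" and b: "b = (\<Sum>i\<in>I. (b \<bullet> f i) *\<^sub>R f i)"
    show "a + b = (\<Sum>i\<in>I. ((a + b) \<bullet> f i) *\<^sub>R f i)"
      unfolding inner_add_left scaleR_add_left sum.distrib using a b by simp
  next
    fix c a assume a: "a = (\<Sum>i\<in>I. (a \<bullet> f i) *\<^sub>R f i)"
    show "c *\<^sub>R a = (\<Sum>i\<in>I. (c * (a \<bullet> f i)) *\<^sub>R f i)"
      using arg_cong[OF a, of "(*\<^sub>R) c"] by (simp add: scaleR_sum_right)
  qed
next
  case (step y)
  then obtain j where j: "j \<in> I" "y = f j" by auto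
  have "(\<Sum>i\<in>I. (y \<bullet> f i) *\<^sub>R f i) = (\<Sum>i\<in>I. if i = j then f i else 0)"
    using assms(2) j by (intro sum.cong) (auto simp: orthonormal_onD)
  then show ?case using j assms(1) by simp
qed

lemma parseval:
  assumes "finite I" "orthonormal_on I f" "x \<in> span (f ` I)"
  shows "(\<Sum>i\<in>I. (x \<bullet> f i)\<^sup>2) = x \<bullet> x"
proof -
  have "x \<bullet> x = x \<bullet> (\<Sum>i\<in>I. (x \<bullet> f i) *\<^sub>R f i)"
    using orthonormal_expansion[OF assms] by simp
  then show ?thesis by (simp add: inner_sum_right power2_eq_square)
qed

lemma bessel:
  assumes "finite I" "orthonormal_on I f"
  shows "(\<Sum>i\<in>I. (x \<bullet> f i)\<^sup>2) \<le> x \<bullet> x"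
proof -
  let ?y = "\<Sum>i\<in>I. (x \<bullet> f i) *\<^sub>R f i"
  have xy: "x \<bullet> ?y = (\<Sum>i\<in>I. (x \<bullet> f i)\<^sup>2)"
    by (simp add: inner_sum_right power2_eq_square)
  have "?y \<bullet> ?y = (\<Sum>i\<in>I. (x \<bullet> f i) * (?y \<bullet> f i))"
    by (simp only: inner_sum_right[of ?y] inner_scaleR_right)
  also have "\<dots> = (\<Sum>i\<in>I. (x \<bullet> f i)\<^sup>2)"
    using assms by (intro sum.cong) (simp_all add: inner_sum_orthonormal[of I f I] power2_eq_square)
  finally have "(x - ?y) \<bullet> (x - ?y) = x \<bullet> x - (\<Sum>i\<in>I. (x \<bullet> f i)\<^sup>2)"
    using xy by (simp add: inner_diff_left inner_diff_right inner_commute)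
  then show ?thesis using inner_ge_zero[of "x - ?y"] by linarith
qed

lemma dim_span_orthonormal:
  fixes f :: "'i \<Rightarrow> 'a::euclidean_space"
  assumes "orthonormal_on I f"
  shows "dim (span (f ` I)) = card I"
proof -
  have "inj_on f I"
    using assms by (metis (no_types, lifting) inj_onI orthonormal_onD zero_neq_one)
  moreover have "independent (f ` I)"
    using assms
    by (intro pairwise_orthogonal_independent)
       (force simp: pairwise_def orthogonal_def orthonormal_on_def)+
  ultimately show ?thesis
    by (simp add: dim_eq_card_independent card_image)
qed

lemma orthonormal_basis_of_subspace:
  fixes V :: "'a::euclidean_space set"
  assumes "subspace V"
  obtains B where "finite B" "orthonormal_on B id" "span B = V" "card B = dim V"
proof -
  obtain B where B: "pairwise orthogonal B" "\<And>x. x \<in> B \<Longrightarrow> norm x = 1" "independent B"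
    "card B = dim V" "span B = V"
    using orthonormal_basis_subspace[OF assms] by metis
  have "orthonormal_on B id"
    using B(1,2) by (auto simp: orthonormal_on_def pairwise_def orthogonal_def norm_eq_1)
  then show thesis using that B independent_imp_finite by blast
qed

subsection \<open>The spectral theorem and singular value decompositions\<close>

text \<open>A maximizer \<open>u\<close> of the quadratic form on the unit sphere of
  \<open>U\<close> is an eigenvector: otherwise moving from \<open>u\<close> along the residual
  \<open>w\<close> would raise the Rayleigh quotient to first order.\<close>

lemma selfadjoint_eigenvector:
  fixes f :: "'a::euclidean_space \<Rightarrow> 'a"
  assumes f: "linear f" and sa: "\<And>x y. f x \<bullet> y = x \<bullet> f y"
    and U: "subspace U" "f ` U \<subseteq> U" "U \<noteq> {0}"
  obtains u l where "u \<in> U" "u \<bullet> u = 1" "f u = l *\<^sub>R u"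
proof -
  let ?K = "sphere 0 1 \<inter> U"
  have "compact ?K"
    using U(1) by (intro compact_Int_closed closed_subspace) auto
  moreover obtain x where "x \<in> U" "x \<noteq> 0"
    using U subspace_0 by blast
  then have "x /\<^sub>R norm x \<in> ?K" using U(1) by (simp add: subspace_scale)
  then have "?K \<noteq> {}" by blast
  moreover have "continuous_on ?K (\<lambda>v. v \<bullet> f v)"
    using f by (intro continuous_intros linear_continuous_on) (simp add: linear_conv_bounded_linear)
  ultimately obtain u where u: "u \<in> ?K" and max: "\<And>v. v \<in> ?K \<Longrightarrow> v \<bullet> f v \<le> u \<bullet> f u"
    using continuous_attains_sup[of ?K] by blast
  define M where "M = u \<bullet> f u"
  define w where "w = f u - M *\<^sub>R u"
  have uu: "u \<bullet> u = 1" using u by (simp add: norm_eq_1)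
  have le: "v \<bullet> f v \<le> M * (v \<bullet> v)" if "v \<in> U" for v
  proof (cases "v = 0")
    case False
    have "v /\<^sub>R norm v \<in> ?K" using False that U(1) by (simp add: subspace_scale)
    from max[OF this] have "(v \<bullet> f v) / (norm v)\<^sup>2 \<le> M"
      using f by (simp add: M_def linear_scale power2_eq_square divide_inverse algebra_simps)
    then show ?thesis
      using False by (simp add: divide_le_eq power2_norm_eq_inner)
  qed (simp add: f linear_0)
  have wU: "w \<in> U"
    using u U by (auto simp: w_def subspace_diff subspace_scale)
  have uw: "u \<bullet> w = 0" by (simp add: w_def inner_diff_right M_def uu)
  have fuw: "w \<bullet> f u = w \<bullet> w" using uw by (simp add: w_def inner_diff_right inner_commute)
  define c where "c = M * (w \<bullet> w) - w \<bullet> f w"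
  \<comment> \<open>Maximality of \<open>u\<close> tested at \<open>u + t w\<close>: the gain
    \<open>2 t |w|^2\<close> is of first order, the loss \<open>t^2 c\<close> only of second
    order.\<close>
  have quad: "2 * t * (w \<bullet> w) \<le> t\<^sup>2 * c" for t :: real
  proof -
    have "u + t *\<^sub>R w \<in> U" using u wU U(1) by (simp add: subspace_add subspace_scale)
    from le[OF this] have
      "u \<bullet> f u + 2 * t * (w \<bullet> f u) + t\<^sup>2 * (w \<bullet> f w) \<le> M * (1 + t\<^sup>2 * (w \<bullet> w))"
      using uu uw sa[of u w]
      by (simp add: linear_add[OF f] linear_scale[OF f] inner_add_left inner_add_right
          power2_eq_square inner_commute algebra_simps)
    then show ?thesis using fuw by (simp add: c_def M_def algebra_simps)
  qed
  have "w \<bullet> w = 0"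
  proof (rule ccontr)
    assume "w \<bullet> w \<noteq> 0"
    then have a: "w \<bullet> w > 0" by simp
    \<comment> \<open>Small enough that \<open>?t * c\<close> does not exceed \<open>|w|^2\<close>;
      the \<open>+ 1\<close> keeps the denominator positive when \<open>c = 0\<close>.\<close>
    let ?t = "(w \<bullet> w) / (\<bar>c\<bar> + 1)"
    have t: "?t > 0" using a by simp
    have "2 * (w \<bullet> w) \<le> ?t * c"
    proof -
      have "?t * (2 * (w \<bullet> w)) \<le> ?t * (?t * c)"
        using quad[of ?t] by (simp add: power2_eq_square mult_ac)
      then show ?thesis using t by (simp only: mult_le_cancel_left_pos)
    qed
    also have "\<dots> \<le> ?t * (\<bar>c\<bar> + 1)" using t by (intro mult_left_mono) auto
    also have "\<dots> = w \<bullet> w" by simp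
    finally show False using a by simp
  qed
  then have "f u = M *\<^sub>R u" by (simp add: w_def)
  then show thesis using that u uu by blast
qed

text \<open>Induction on the dimension: by self-adjointness the orthogonal complement of an
  eigenvector is invariant again.\<close>

lemma selfadjoint_eigenbasis:
  fixes f :: "'a::euclidean_space \<Rightarrow> 'a"
  assumes f: "linear f" and sa: "\<And>x y. f x \<bullet> y = x \<bullet> f y"
    and "subspace U" "f ` U \<subseteq> U"
  shows "\<exists>B. finite B \<and> orthonormal_on B id \<and> span B = U \<and> (\<forall>b\<in>B. \<exists>l. f b = l *\<^sub>R b)"
  using assms(3,4)
proof (induction "dim U" arbitrary: U rule: less_induct)
  case less
  show ?case
  proof (cases "U = {0}")
    case True
    then show ?thesis by (intro exI[of _ "{}"]) (simp add: orthonormal_on_def)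
  next
    case False
    obtain u l where u: "u \<in> U" "u \<bullet> u = 1" "f u = l *\<^sub>R u"
      using selfadjoint_eigenvector[OF f sa less.prems False] by blast
    define V where "V = {y \<in> U. u \<bullet> y = 0}"
    have V: "subspace V"
      using less.prems(1) unfolding V_def
      by (auto simp: subspace_def inner_add_right)
    have "f ` V \<subseteq> V"
    proof
      fix y assume "y \<in> f ` V"
      then obtain x where x: "x \<in> U" "u \<bullet> x = 0" "y = f x" by (auto simp: V_def)
      have "u \<bullet> f x = 0" using sa[of u x] u(3) x(2) by simp
      then show "y \<in> V" using x less.prems(2) by (auto simp: V_def)
    qed
    moreover have "u \<notin> V" using u by (simp add: V_def)
    then have "V \<subset> U" using u(1) unfolding V_def by blast
    then have "dim V < dim U"
      using V less.prems(1) by (metis dim_psubset span_eq_iff)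
    ultimately obtain B where B: "finite B" "orthonormal_on B id" "span B = V"
      "\<forall>b\<in>B. \<exists>l. f b = l *\<^sub>R b"
      using less.hyps V by blast
    have uB: "u \<bullet> b = 0" if "b \<in> B" for b
      using that B(3) span_base[of b B] by (simp add: V_def)
    have "orthonormal_on (insert u B) id"
      using B(2) u(2) uB by (auto simp: orthonormal_on_def inner_commute)
    moreover have "span (insert u B) = U"
    proof
      have "insert u B \<subseteq> U" using u(1) B(3) span_superset[of B] by (auto simp: V_def)
      then show "span (insert u B) \<subseteq> U" using less.prems(1) span_minimal by blast
      show "U \<subseteq> span (insert u B)"
      proof
        fix x assume x: "x \<in> U"
        have "x - (x \<bullet> u) *\<^sub>R u \<in> V"
          using x u less.prems(1)
          by (simp add: V_def subspace_diff subspace_scale inner_diff_right inner_commute)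
        then show "x \<in> span (insert u B)" using B(3) span_breakdown_eq by blast
      qed
    qed
    ultimately show ?thesis
      using B u(3) by (intro exI[of _ "insert u B"]) auto
  qed
qed

definition outer :: "real^'m \<Rightarrow> real^'n \<Rightarrow> real^'n^'m" where
  "outer u v = (\<chi> i j. u $ i * v $ j)"

lemma outer_mult_vec: "outer u v *v x = (v \<bullet> x) *\<^sub>R u"
  by (simp add: outer_def vec_eq_iff matrix_vector_mult_def inner_vec_def sum_distrib_left
      mult.assoc mult.left_commute sum_distrib_right mult.commute)

lemma inner_outer: "X \<bullet> outer u v = u \<bullet> (X *v v)"
  by (simp add: outer_def matrix_vector_mult_def inner_vec_def sum_distrib_left
      mult.assoc mult.left_commute mult.commute)

lemma inner_outer_outer: "outer u v \<bullet> outer u' v' = (u \<bullet> u') * (v \<bullet> v')"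
  by (simp add: inner_outer outer_mult_vec inner_commute)

lemma sum_matrix_vector_mult: "(\<Sum>i\<in>I. f i) *v x = (\<Sum>i\<in>I. f i *v x)"
  by (induction I rule: infinite_finite_induct) (auto simp: matrix_vector_mult_add_rdistrib)

lemma scaleR_matrix_vector_mult: "(c *\<^sub>R A) *v x = c *\<^sub>R (A *v x)" for A :: "real^'n^'m"
  by (simp add: scaleR_matrix_vector_assoc)

lemma sum_outer_mult_vec:
  "(\<Sum>i\<in>I. c i *\<^sub>R outer (p i) (q i)) *v x = (\<Sum>i\<in>I. (c i * (q i \<bullet> x)) *\<^sub>R p i)"
  by (simp add: sum_matrix_vector_mult scaleR_matrix_vector_mult outer_mult_vec)

lemma rank_sum_outer_le:
  assumes "finite I"
  shows "rank (\<Sum>i\<in>I. c i *\<^sub>R outer (p i) (q i)) \<le> card I"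
proof -
  have "range (\<lambda>x. (\<Sum>i\<in>I. c i *\<^sub>R outer (p i) (q i)) *v x) \<subseteq> span (p ` I)"
    unfolding sum_outer_mult_vec by (auto intro!: span_sum intro: span_scale span_base)
  from dim_subset[OF this] have "rank (\<Sum>i\<in>I. c i *\<^sub>R outer (p i) (q i)) \<le> dim (p ` I)"
     by (simp add: rank_dim_range)
  also have "\<dots> \<le> card I"
    using dim_le_card'[of "p ` I"] card_image_le[of I p] assms by simp
  finally show ?thesis .
qed

text \<open>Only the positive singular values occur, and each is indexed by its right singular vector.\<close>

definition is_svd ::
  "real^'n^'m \<Rightarrow> (real^'n) set \<Rightarrow> (real^'n \<Rightarrow> real^'m) \<Rightarrow> (real^'n \<Rightarrow> real) \<Rightarrow> bool" where
  "is_svd X Q p s \<longleftrightarrow> finite Q \<and> orthonormal_on Q id \<and> orthonormal_on Q p \<and> (\<forall>q\<in>Q. s q > 0) \<and>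
     X = (\<Sum>q\<in>Q. s q *\<^sub>R outer (p q) q)"

text \<open>\<open>X\<close> maps \<open>q / s q\<close> to \<open>p q\<close>, so its range
  contains an orthonormal family of size \<open>card Q\<close>.\<close>

lemma card_le_rank_svd:
  assumes "is_svd X Q p s"
  shows "card Q \<le> rank X"
proof -
  have "X *v q = s q *\<^sub>R p q" if "q \<in> Q" for q
  proof -
    have "X *v q = (\<Sum>k\<in>Q. (s k * (k \<bullet> q)) *\<^sub>R p k)"
    proof -
      have "X = (\<Sum>q\<in>Q. s q *\<^sub>R outer (p q) q)" using assms by (simp add: is_svd_def)
      from arg_cong[OF this, of "\<lambda>X. X *v q"] show ?thesis unfolding sum_outer_mult_vec .
    qed
    also have "\<dots> = (\<Sum>k\<in>Q. if k = q then s k *\<^sub>R p k else 0)"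
      using assms that by (intro sum.cong) (auto simp: is_svd_def orthonormal_on_def)
    finally have "X *v q = (\<Sum>k\<in>Q. if k = q then s k *\<^sub>R p k else 0)" .
    then show ?thesis using assms that by (simp add: is_svd_def)
  qed
  then have "X *v (q /\<^sub>R s q) = p q" if "q \<in> Q" for q
    using that assms by (force simp: is_svd_def linear_scale[OF matrix_vector_mul_linear])
  then have "p ` Q \<subseteq> range (\<lambda>x. X *v x)" by (metis image_subsetI rangeI)
  then have "dim (p ` Q) \<le> rank X" by (simp add: rank_dim_range dim_subset)
  then show ?thesis
    using assms by (metis is_svd_def dim_span dim_span_orthonormal)
qed

text \<open>In a nonincreasing nonnegative list the nonzero entries come first, so the cut loses
  only zeros, where \<open>g\<close> vanishes. This handles the truncation in
  \<open>singular_value_list\<close>.\<close>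

lemma sum_list_take_eq:
  fixes L :: "real list" and g :: "real \<Rightarrow> 'b::comm_monoid_add"
  assumes "sorted (rev L)" "\<forall>x\<in>set L. 0 \<le> x" "length (filter (\<lambda>x. x \<noteq> 0) L) \<le> k" "g 0 = 0"
  shows "sum_list (map g (take k L)) = sum_list (map g L)"
proof -
  have "L ! i = 0" if i: "k \<le> i" "i < length L" for i
  proof (rule ccontr)
    assume "L ! i \<noteq> 0"
    then have pos: "L ! i > 0" using assms(2) i by (metis nth_mem order_le_less)
    have "L ! j > 0" if "j \<le> i" for j
    proof -
      have "L ! i \<le> L ! j"
        using assms(1) that i by (simp add: sorted_rev_iff_nth_mono)
      then show ?thesis using pos by linarith
    qed
    then have "{..i} \<subseteq> {j. j < length L \<and> L ! j \<noteq> 0}" using i by force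
    then have "card {..i} \<le> length (filter (\<lambda>x. x \<noteq> 0) L)"
      unfolding length_filter_conv_card by (intro card_mono) auto
    then show False using assms(3) i by simp
  qed
  then have "\<forall>x\<in>set (drop k L). x = 0"
    by (auto simp: in_set_conv_nth)
  then have "map g (drop k L) = map (\<lambda>_. 0) (drop k L)"
    using assms(4) by (metis (no_types, lifting) map_eq_conv)
  then have "sum_list (map g (drop k L)) = 0"
    by (simp only: sum_list_0)
  moreover have "sum_list (map g L) = sum_list (map g (take k L)) + sum_list (map g (drop k L))"
    by (metis append_take_drop_id map_append sum_list_append)
  ultimately show ?thesis by simp
qed

lemma sorted_concat_replicate:
  assumes "sorted xs"
  shows "sorted (concat (map (\<lambda>x. replicate (n x) x) xs))"
  using assms by (induction xs) (auto simp: sorted_append)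

lemma rev_concat_replicate:
  "rev (concat (map (\<lambda>x. replicate (n x) x) xs)) = concat (map (\<lambda>x. replicate (n x) x) (rev xs))"
  by (induction xs) auto

text \<open>The link from the defined singular values to decompositions, obtained from an eigenbasis
  of \<open>X^T X\<close>. Quantifying over \<open>g\<close> with \<open>g 0 = 0\<close> serves the
  nuclear norm and the penalty at once and hides the zero singular values, which the decomposition
  omits.\<close>

lemma ex_svd:
  fixes X :: "real^'n^'m"
  shows "\<exists>Q p s. is_svd X Q p s \<and>
    (\<forall>g::real \<Rightarrow> real. g 0 = 0 \<longrightarrow>
      (\<Sum>i=1..min_dim X. g (singular_value X i)) = (\<Sum>q\<in>Q. g (s q)))"
proof -
  let ?S = "transpose X ** X"
  let ?f = "\<lambda>v. ?S *v v"
  have inner_f: "?f x \<bullet> y = (X *v x) \<bullet> (X *v y)" for x y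
    by (simp add: matrix_vector_mul_assoc[symmetric] dot_lmul_matrix)
  then have sa: "?f x \<bullet> y = x \<bullet> ?f y" for x y
    by (metis inner_commute)
  obtain B where B: "finite B" "orthonormal_on B id" "span B = UNIV"
    "\<And>b. b \<in> B \<Longrightarrow> \<exists>l. ?f b = l *\<^sub>R b"
    using selfadjoint_eigenbasis[of ?f UNIV] sa by auto
  \<comment> \<open>The eigenvalue of \<open>X^T X\<close> at a unit eigenvector \<open>b\<close> is
    \<open>|X b|^2\<close>, so this is its singular value.\<close>
  define s where "s b = norm (X *v b)" for b
  have eig: "?f b = (s b)\<^sup>2 *\<^sub>R b" if b: "b \<in> B" for b
  proof -
    obtain l where l: "?f b = l *\<^sub>R b" using B(4)[OF b] by blast
    have "b \<bullet> b = 1" using B(2) b by (auto simp: orthonormal_on_def)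
    then have "l = (X *v b) \<bullet> (X *v b)" using inner_f[of b b] by (simp add: l)
    then show ?thesis using l by (simp add: s_def power2_norm_eq_inner)
  qed
  have expand: "v = (\<Sum>b\<in>B. (v \<bullet> b) *\<^sub>R b)" for v
    using orthonormal_expansion[OF B(1,2), of v] B(3) by simp
  define Q where "Q = {b\<in>B. s b \<noteq> 0}"
  define p where "p b = (X *v b) /\<^sub>R s b" for b
  have svd: "is_svd X Q p s"
    unfolding is_svd_def
  proof (intro conjI)
    show "finite Q" using B(1) by (simp add: Q_def)
    show "orthonormal_on Q id" using B(2) by (rule orthonormal_on_subset) (auto simp: Q_def)
    show "\<forall>q\<in>Q. s q > 0" by (auto simp: Q_def s_def)
    show "orthonormal_on Q p"
      unfolding orthonormal_on_def
    proof (intro ballI)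
      fix q q' assume q: "q \<in> Q" "q' \<in> Q"
      have "p q \<bullet> p q' = (?f q \<bullet> q') / (s q * s q')"
        by (simp add: p_def inner_f field_simps)
      also have "\<dots> = (if q = q' then 1 else 0)"
        using q B(2) by (auto simp: Q_def eig orthonormal_on_def power2_eq_square)
      finally show "p q \<bullet> p q' = (if q = q' then 1 else 0)" .
    qed
    show "X = (\<Sum>q\<in>Q. s q *\<^sub>R outer (p q) q)"
    proof (rule matrix_eq[THEN iffD2], rule allI)
      fix x
      have "X *v x = (\<Sum>b\<in>B. (x \<bullet> b) *\<^sub>R (X *v b))"
        by (subst expand[of x], subst linear_sum[OF matrix_vector_mul_linear])
           (simp add: linear_scale[OF matrix_vector_mul_linear])
      also have "\<dots> = (\<Sum>b\<in>Q. (x \<bullet> b) *\<^sub>R (X *v b))"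
        using B(1) by (intro sum.mono_neutral_right) (auto simp: Q_def s_def)
      also have "\<dots> = (\<Sum>q\<in>Q. s q *\<^sub>R outer (p q) q) *v x"
        unfolding sum_outer_mult_vec
        by (intro sum.cong) (auto simp: Q_def p_def inner_commute)
      finally show "X *v x = (\<Sum>q\<in>Q. s q *\<^sub>R outer (p q) q) *v x" .
    qed
  qed
  \<comment> \<open>An eigenvector for \<open>t\<close> is orthogonal to every basis vector with
    another eigenvalue, so only those with eigenvalue \<open>t\<close> remain in its
    expansion.\<close>
  have eigenspace: "eigenspace ?S t = span {b\<in>B. (s b)\<^sup>2 = t}" for t
  proof
    show "span {b\<in>B. (s b)\<^sup>2 = t} \<subseteq> eigenspace ?S t"
      by (intro span_minimal)
         (auto simp: eigenspace_def subspace_def eig matrix_vector_right_distrib scaleR_add_right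
           linear_scale[OF matrix_vector_mul_linear])
    show "eigenspace ?S t \<subseteq> span {b\<in>B. (s b)\<^sup>2 = t}"
    proof
      fix v assume "v \<in> eigenspace ?S t"
      then have fv: "?f v = t *\<^sub>R v" by (simp add: eigenspace_def)
      have zero: "v \<bullet> b = 0" if "b \<in> B" "(s b)\<^sup>2 \<noteq> t" for b
        using sa[of v b] that by (simp add: fv eig)
      have "v = (\<Sum>b\<in>{b\<in>B. (s b)\<^sup>2 = t}. (v \<bullet> b) *\<^sub>R b)"
        by (subst expand[of v], intro sum.mono_neutral_right) (use B(1) zero in auto)
      also have "\<dots> \<in> span {b\<in>B. (s b)\<^sup>2 = t}"
        by (intro span_sum span_scale span_base)
      finally show "v \<in> span {b\<in>B. (s b)\<^sup>2 = t}" .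
    qed
  qed
  have s0: "s b \<ge> 0" for b by (simp add: s_def)
  have dim_eig: "dim (eigenspace ?S (t\<^sup>2)) = card {b\<in>B. s b = t}" if "t \<ge> 0" for t
  proof -
    have "{b\<in>B. (s b)\<^sup>2 = t\<^sup>2} = {b\<in>B. s b = t}" using that s0 by auto
    moreover have "orthonormal_on {b\<in>B. s b = t} id"
      using B(2) by (rule orthonormal_on_subset) auto
    ultimately show ?thesis
      using dim_span_orthonormal[of "{b\<in>B. s b = t}" id] by (simp add: eigenspace)
  qed
  have nontriv: "span {b\<in>B. s b = t} \<noteq> {0} \<longleftrightarrow> t \<in> s ` B" for t
  proof
    assume "span {b\<in>B. s b = t} \<noteq> {0}"
    then have "{b\<in>B. s b = t} \<noteq> {}" by (metis span_empty)
    then show "t \<in> s ` B" by blast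
  next
    assume "t \<in> s ` B"
    then obtain b where b: "b \<in> B" "s b = t" by auto
    then have "b \<in> span {b\<in>B. s b = t}" by (simp add: span_base)
    moreover have "b \<bullet> b = 1" using B(2) b by (auto simp: orthonormal_on_def)
    then have "b \<noteq> 0" by auto
    ultimately show "span {b\<in>B. s b = t} \<noteq> {0}" by blast
  qed
  have sset: "singular_set X = s ` B"
  proof -
    have "t \<in> singular_set X \<longleftrightarrow> t \<in> s ` B" for t
    proof (cases "t \<ge> 0")
      case True
      have "{b\<in>B. (s b)\<^sup>2 = t\<^sup>2} = {b\<in>B. s b = t}" using True s0 by auto
      then show ?thesis using True nontriv by (simp add: singular_set_def eigenspace)
    next
      case False
      then show ?thesis using s0 by (auto simp: singular_set_def)
    qed
    then show ?thesis by blast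
  qed
  define L where "L = concat (map (\<lambda>t. replicate (dim (eigenspace ?S (t\<^sup>2))) t)
         (rev (sorted_list_of_set (singular_set X))))"
  have list: "singular_value_list X = take (min_dim X) L"
    by (simp add: singular_value_list_def L_def)
  \<comment> \<open>Stated over any semiring: natural values give the length and the number of
    nonzero entries, real values the spectral sums.\<close>
  have sumL: "sum_list (map g L) = (\<Sum>b\<in>B. g (s b))" for g :: "real \<Rightarrow> 'b::comm_semiring_1"
  proof -
    have "sum_list (map g (concat (map (\<lambda>t. replicate (n t) t) xs)))
        = (\<Sum>t\<leftarrow>xs. of_nat (n t) * g t)" for n xs
      by (induction xs) (simp_all add: sum_list_replicate)
    then have "sum_list (map g L) =
        (\<Sum>t\<leftarrow>rev (sorted_list_of_set (s ` B)). of_nat (dim (eigenspace ?S (t\<^sup>2))) * g t)"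
      by (simp add: L_def sset)
    also have "\<dots> = (\<Sum>t\<in>s ` B. of_nat (dim (eigenspace ?S (t\<^sup>2))) * g t)"
      using B(1) by (subst sum_list_distinct_conv_sum_set) auto
    also have "\<dots> = (\<Sum>t\<in>s ` B. \<Sum>b | b \<in> B \<and> s b = t. g (s b))"
    proof (rule sum.cong)
      fix t assume "t \<in> s ` B"
      then have "t \<ge> 0" using s0 by auto
      then show "of_nat (dim (eigenspace ?S (t\<^sup>2))) * g t = (\<Sum>b | b \<in> B \<and> s b = t. g (s b))"
        by (simp add: dim_eig)
    qed simp
    also have "\<dots> = (\<Sum>b\<in>B. g (s b))"
      using B(1) by (rule sum.image_gen[symmetric])
    finally show ?thesis .
  qed
  \<comment> \<open>The multiplicities add up to the size of an orthonormal basis; hence every index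
    up to \<open>min_dim X\<close> is in range.\<close>
  have lenL: "length L = CARD('n)"
  proof -
    have "length L = card B" using sumL[of "\<lambda>_. 1::nat"] by (simp add: sum_list_triv)
    also have "\<dots> = CARD('n)"
      using dim_span_orthonormal[OF B(2)] B(3) by simp
    finally show ?thesis .
  qed
  have "length (filter (\<lambda>x. x \<noteq> 0) L) = sum_list (map (\<lambda>x. if x \<noteq> 0 then 1 else 0) L)"
    by (induction L) auto
  also have "\<dots> = card Q"
    using B(1) by (simp add: sumL Q_def sum.If_cases Int_def)
  also have "\<dots> \<le> min_dim X"
    using card_le_rank_svd[OF svd] rank_bound[of X] by (simp add: min_dim_def)
  finally have few: "length (filter (\<lambda>x. x \<noteq> 0) L) \<le> min_dim X" .
  have "sorted (rev L)"
    unfolding L_def rev_concat_replicate by (simp add: sorted_concat_replicate)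
  moreover have "\<forall>x\<in>set L. 0 \<le> x"
    using finite_singular_set[of X] by (auto simp: L_def singular_set_def)
  ultimately have take: "sum_list (map g (take (min_dim X) L)) = (\<Sum>b\<in>B. g (s b))"
    if "g 0 = 0" for g :: "real \<Rightarrow> real"
    using sum_list_take_eq[OF _ _ few, of g] that sumL[of g] by simp
  have "(\<Sum>i=1..min_dim X. g (singular_value X i)) = (\<Sum>q\<in>Q. g (s q))"
    if g: "g 0 = 0" for g :: "real \<Rightarrow> real"
  proof -
    have len: "length (singular_value_list X) = min_dim X"
      by (simp add: list lenL min_dim_def)
    have "(\<Sum>i=1..min_dim X. g (singular_value X i))
        = (\<Sum>i<min_dim X. g (singular_value_list X ! i))"
      unfolding singular_value_def
      by (rule sum.reindex_bij_witness[of _ Suc "\<lambda>i. i - 1"]) auto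
    also have "\<dots> = sum_list (map g (singular_value_list X))"
      by (simp add: sum_list_sum_nth len atLeast0LessThan)
    also have "\<dots> = (\<Sum>b\<in>B. g (s b))" using take g by (simp add: list)
    also have "\<dots> = (\<Sum>q\<in>Q. g (s q))"
      using B(1) g by (intro sum.mono_neutral_right) (auto simp: Q_def)
    finally show ?thesis .
  qed
  then show ?thesis using svd by blast
qed

subsection \<open>Sums of the largest entries\<close>

text \<open>Ties make such a set non-unique; the minimum covers index sets with fewer than
  \<open>r\<close> elements, where \<open>T\<close> is all of \<open>Q\<close>.\<close>

definition is_top :: "nat \<Rightarrow> ('i \<Rightarrow> real) \<Rightarrow> 'i set \<Rightarrow> 'i set \<Rightarrow> bool" where
  "is_top r w Q T \<longleftrightarrow> T \<subseteq> Q \<and> card T = min r (card Q) \<and> (\<forall>q\<in>T. \<forall>q'\<in>Q - T. w q' \<le> w q)"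

lemma ex_is_top:
  assumes "finite Q"
  shows "\<exists>T. is_top r w Q T"
proof (induction r)
  case 0
  then show ?case by (intro exI[of _ "{}"]) (simp add: is_top_def)
next
  case (Suc r)
  then obtain T where T: "is_top r w Q T" by blast
  show ?case
  proof (cases "Q \<subseteq> T")
    case True
    then have "T = Q" using T by (auto simp: is_top_def)
    then show ?thesis using T by (intro exI[of _ T]) (auto simp: is_top_def)
  next
    case False
    have fin: "finite T" "finite (Q - T)"
      using T assms finite_subset by (auto simp: is_top_def)
    have "\<exists>q\<in>Q - T. \<forall>q'\<in>Q - T. w q' \<le> w q"
    proof -
      have "Max (w ` (Q - T)) \<in> w ` (Q - T)" using False fin by (intro Max_in) auto
      then obtain q where "q \<in> Q - T" "w q = Max (w ` (Q - T))" by auto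
      then show ?thesis using fin by (intro bexI[of _ q]) auto
    qed
    then obtain q where q: "q \<in> Q - T" "\<forall>q'\<in>Q - T. w q' \<le> w q" by blast
    have "card T < card Q"
      using T q assms by (intro psubset_card_mono) (auto simp: is_top_def)
    then have "card (insert q T) = min (Suc r) (card Q)"
      using T q fin by (auto simp: is_top_def min_def split: if_splits)
    then have "is_top (Suc r) w Q (insert q T)"
      using T q by (auto simp: is_top_def)
    then show ?thesis by blast
  qed
qed

text \<open>\<open>m\<close> is the largest value outside \<open>T\<close>. If nothing is outside,
  \<open>0\<close> serves; otherwise \<open>T\<close> is a proper subset and has exactly
  \<open>r\<close> elements.\<close>

lemma top_threshold:
  assumes "finite Q" "is_top r w Q T" "\<forall>q\<in>Q. 0 \<le> w q"
  obtains m where "0 \<le> m" "\<forall>q\<in>T. m \<le> w q" "\<forall>q\<in>Q - T. w q \<le> m" "m = 0 \<or> card T = r"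
proof (cases "Q \<subseteq> T")
  case True
  show ?thesis
    by (rule that[of 0]) (use assms True in \<open>auto simp: is_top_def\<close>)
next
  case False
  have fin: "finite (Q - T)" using assms by simp
  have "Max (w ` (Q - T)) \<in> w ` (Q - T)" using False fin by (intro Max_in) auto
  then obtain q where q: "q \<in> Q - T" "Max (w ` (Q - T)) = w q" by auto
  have "card T < card Q"
    using assms(1,2) q by (intro psubset_card_mono) (auto simp: is_top_def)
  then have "card T = r" using assms(2) by (auto simp: is_top_def min_def split: if_splits)
  moreover have "\<forall>q'\<in>Q - T. w q' \<le> w q" using q fin by (metis Max_ge finite_imageI imageI)
  ultimately show ?thesis
    using that[of "w q"] assms(2,3) q by (auto simp: is_top_def)
qed

text \<open>A fractional knapsack: with weights at most one and total at most \<open>r\<close>, full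
  weight on the \<open>r\<close> largest entries is optimal. It serves both the trace estimate for
  \<open>W\<close> and the extremal tail.\<close>

lemma weighted_sum_le_top:
  assumes Q: "finite Q" and T: "is_top r w Q T" and w: "\<forall>q\<in>Q. 0 \<le> w q"
    and c: "\<forall>q\<in>Q. 0 \<le> c q \<and> c q \<le> 1" and sum_c: "(\<Sum>q\<in>Q. c q) \<le> real r"
  shows "(\<Sum>q\<in>Q. c q * w q) \<le> (\<Sum>q\<in>T. w q)"
proof -
  obtain m where m: "0 \<le> m" "\<forall>q\<in>T. m \<le> w q" "\<forall>q\<in>Q - T. w q \<le> m" "m = 0 \<or> card T = r"
    using top_threshold[OF Q T w] by blast
  have TQ: "T \<subseteq> Q" using T by (simp add: is_top_def)
  have split: "sum h Q = sum h (Q - T) + sum h T" for h :: "'a \<Rightarrow> real"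
    using sum.subset_diff[OF TQ Q] .
  have "(\<Sum>q\<in>Q - T. c q * w q) \<le> (\<Sum>q\<in>Q - T. c q * m)"
    using c m by (intro sum_mono mult_left_mono) auto
  also have "\<dots> = m * (\<Sum>q\<in>Q - T. c q)" by (simp add: sum_distrib_left mult.commute)
  \<comment> \<open>Weight spent outside \<open>T\<close> is missing inside it, because the total is
    at most \<open>r = card T\<close>; for \<open>m = 0\<close> both sides vanish.\<close>
  also have "\<dots> \<le> m * (\<Sum>q\<in>T. 1 - c q)"
  proof (cases "m = 0")
    case False
    then have "(\<Sum>q\<in>Q - T. c q) \<le> (\<Sum>q\<in>T. 1 - c q)"
      using m(4) sum_c split[of c] by (simp add: sum_subtractf)
    then show ?thesis using m(1) by (rule mult_left_mono)
  qed simp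
  also have "\<dots> = (\<Sum>q\<in>T. (1 - c q) * m)" by (simp add: sum_distrib_left mult.commute)
  also have "\<dots> \<le> (\<Sum>q\<in>T. (1 - c q) * w q)"
    using c m TQ by (intro sum_mono mult_left_mono) auto
  finally show ?thesis
    using split[of "\<lambda>q. c q * w q"] by (simp add: algebra_simps sum_subtractf)
qed

subsection \<open>Perturbation of the nuclear norm\<close>

text \<open>The eigenvectors of the symmetric dilation of \<open>X\<close>, whose quadratic form is
  \<open>(a, b) \<mapsto> 2 a \<bullet> X b\<close>.\<close>

definition dil_pos :: "(real^'n \<Rightarrow> real^'m) \<Rightarrow> real^'n \<Rightarrow> (real^'m) \<times> (real^'n)" where
  "dil_pos p q = (1 / sqrt 2) *\<^sub>R (p q, q)"

definition dil_neg :: "(real^'n \<Rightarrow> real^'m) \<Rightarrow> real^'n \<Rightarrow> (real^'m) \<times> (real^'n)" where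
  "dil_neg p q = (1 / sqrt 2) *\<^sub>R (p q, - q)"

lemma dil_orthonormal:
  assumes "is_svd X Q p s"
  shows "orthonormal_on Q (dil_pos p)" "orthonormal_on Q (dil_neg p)"
    and "\<And>q q'. q \<in> Q \<Longrightarrow> q' \<in> Q \<Longrightarrow> dil_pos p q \<bullet> dil_neg p q' = 0"
  using assms
  by (auto simp: is_svd_def orthonormal_on_def dil_pos_def dil_neg_def inner_Pair)

text \<open>For \<open>x = (a, b)\<close> the two squares differ by
  \<open>2 (a . p q) (b . q)\<close>: the dilation has eigenvalues \<open>s q\<close> and
  \<open>- s q\<close> on the two families.\<close>

lemma dil_form:
  assumes "is_svd X Q p s"
  shows "2 * (fst x \<bullet> (X *v snd x)) =
    (\<Sum>q\<in>Q. s q * ((x \<bullet> dil_pos p q)\<^sup>2 - (x \<bullet> dil_neg p q)\<^sup>2))"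
proof -
  have "X = (\<Sum>q\<in>Q. s q *\<^sub>R outer (p q) q)" using assms by (simp add: is_svd_def)
  from arg_cong[OF this, of "\<lambda>X. X *v snd x"]
  have "2 * (fst x \<bullet> (X *v snd x)) = (\<Sum>q\<in>Q. 2 * (s q * (q \<bullet> snd x)) * (fst x \<bullet> p q))"
    unfolding sum_outer_mult_vec by (simp add: inner_sum_right sum_distrib_left mult.assoc)
  also have "\<dots> = (\<Sum>q\<in>Q. s q * ((x \<bullet> dil_pos p q)\<^sup>2 - (x \<bullet> dil_neg p q)\<^sup>2))"
    by (intro sum.cong)
       (simp_all add: dil_pos_def dil_neg_def inner_prod_def power_divide inner_commute
         power2_eq_square field_simps)
  finally show ?thesis .
qed

lemma orthonormal_sum_inner_le_1:
  assumes "finite E" "orthonormal_on E f" "x \<bullet> x = 1"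
  shows "(\<Sum>e\<in>E. (f e \<bullet> x)\<^sup>2) \<le> 1"
  using bessel[OF assms(1,2), of x] assms(3) by (simp add: inner_commute)

text \<open>
  In the space of the dilations, choose a subspace that contains the negative eigenvectors of \<open>X\<close>,
  is orthogonal to the positive ones, and has at most \<open>card Q\<close> dimensions outside the negative
  eigenspace of \<open>W\<close>, all but \<open>card Q\<close> dimensions of which it contains.
\<close>

lemma nuclear_norm_perturbation:
  fixes X W :: "real^'n^'m"
  assumes X: "is_svd X Q p s" and W: "is_svd W R u w" and Y: "is_svd (X + W) V v y"
    and r: "card Q \<le> r" and T: "is_top r w R T"
  shows "(\<Sum>q\<in>Q. s q) + (\<Sum>q\<in>R. w q) - 2 * (\<Sum>q\<in>T. w q) \<le> (\<Sum>q\<in>V. y q)"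
proof -
  have fin: "finite Q" "finite R" "finite V" using X W Y by (auto simp: is_svd_def)
  note oX = dil_orthonormal[OF X] and oW = dil_orthonormal[OF W] and oY = dil_orthonormal[OF Y]
  \<comment> \<open>The positive and negative eigenspaces of \<open>X\<close>, and the negative one
    of \<open>W\<close>.\<close>
  define P where "P = span (dil_pos p ` Q)"
  define N where "N = span (dil_neg p ` Q)"
  define G where "G = span (dil_neg u ` R)"
  have dims: "dim P = card Q" "dim N = card Q" "dim G = card R"
    using oX oW by (simp_all add: P_def N_def G_def dim_span_orthonormal del: dim_span)
  have sub: "subspace P" "subspace N" "subspace G" by (simp_all add: P_def N_def G_def)
  define C where "C = {z. \<forall>x\<in>P. orthogonal x z}"
  have subC: "subspace C" unfolding C_def by (rule subspace_orthogonal_to_vectors)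
  have dimC: "dim C + card Q = DIM((real^'m) \<times> (real^'n))"
    using dim_subspace_orthogonal_to_vectors[of P UNIV] sub dims by (simp add: C_def)
  define S where "S = G \<inter> C"
  have subS: "subspace S" unfolding S_def using sub subC by (simp add: subspace_inter)
  \<comment> \<open>Intersecting \<open>G\<close> with the complement of \<open>P\<close> costs at
    most \<open>card Q\<close> dimensions; the additive form avoids truncated subtraction.\<close>
  have dimS: "card R \<le> dim S + card Q"
    using dim_sums_Int[OF sub(3) subC] dims dimC
      dim_subset_UNIV[of "{x + z |x z. x \<in> G \<and> z \<in> C}"]
    unfolding S_def by linarith
  \<comment> \<open>The test subspace. Adding \<open>N\<close> lets the form of \<open>X\<close>
    reach its least trace, at the cost of at most \<open>card Q\<close> directions beyond
    \<open>S\<close>.\<close>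
  define H where "H = {x + z |x z. x \<in> S \<and> z \<in> N}"
  have subH: "subspace H" unfolding H_def using subS sub by (intro subspace_sums)
  have SH: "S \<subseteq> H"
  proof
    fix x assume "x \<in> S"
    then show "x \<in> H" using subspace_0[OF sub(2)] unfolding H_def
      by (intro CollectI exI[of _ x] exI[of _ 0]) simp
  qed
  have NH: "N \<subseteq> H"
  proof
    fix x assume "x \<in> N"
    then show "x \<in> H" using subspace_0[OF subS] unfolding H_def
      by (intro CollectI exI[of _ 0] exI[of _ x]) simp
  qed
  have dimH: "dim H \<le> dim S + card Q"
    using dim_sums_Int[OF subS sub(2)] dims unfolding H_def by linarith
  define D where "D = {z \<in> H. \<forall>x\<in>S. orthogonal x z}"
  have "D = H \<inter> {z. \<forall>x\<in>S. orthogonal x z}" by (auto simp: D_def)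
  then have subD: "subspace D"
    using subH subspace_orthogonal_to_vectors[of S] by (simp add: subspace_inter)
  have dimD: "dim D \<le> card Q"
    using dim_subspace_orthogonal_to_vectors[OF subS subH SH] dimH by (simp add: D_def)
  obtain ES where ES: "finite ES" "orthonormal_on ES id" "span ES = S" "card ES = dim S"
    using orthonormal_basis_of_subspace[OF subS] .
  obtain ED where ED: "finite ED" "orthonormal_on ED id" "span ED = D" "card ED = dim D"
    using orthonormal_basis_of_subspace[OF subD] .
  have ES_S: "ES \<subseteq> S" and ED_D: "ED \<subseteq> D" using ES(3) ED(3) span_superset by blast+
  have SD: "a \<bullet> b = 0" "b \<bullet> a = 0" if "a \<in> S" "b \<in> D" for a b
    using that by (auto simp: D_def orthogonal_def inner_commute)
  have disj: "ES \<inter> ED = {}"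
  proof (rule ccontr)
    assume "ES \<inter> ED \<noteq> {}"
    then obtain e where e: "e \<in> ES" "e \<in> ED" by blast
    then have "e \<bullet> e = 1" using ES(2) by (auto simp: orthonormal_on_def)
    moreover have "e \<bullet> e = 0" using SD(1)[of e e] e ES_S ED_D by blast
    ultimately show False by simp
  qed
  \<comment> \<open>An orthonormal basis of \<open>H\<close> adapted to \<open>S\<close> and
    \<open>D\<close>: \<open>ES\<close> is orthogonal to the positive eigenvectors of
    \<open>W\<close>, and \<open>ED\<close> has at most \<open>card Q\<close> elements.\<close>
  define E where "E = ES \<union> ED"
  have finE: "finite E" using ES ED by (simp add: E_def)
  have oE: "orthonormal_on E id"
    unfolding orthonormal_on_def
  proof (intro ballI)
    fix a b assume "a \<in> E" "b \<in> E"
    then consider "a \<in> ES" "b \<in> ES" | "a \<in> ED" "b \<in> ED" | "a \<in> ES" "b \<in> ED" | "a \<in> ED" "b \<in> ES"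
      by (auto simp: E_def)
    then show "id a \<bullet> id b = (if a = b then 1 else 0)"
    proof cases
      case 1 then show ?thesis using ES(2) by (rule orthonormal_onD[rotated])
    next
      case 2 then show ?thesis using ED(2) by (rule orthonormal_onD[rotated])
    next
      case 3 then show ?thesis using SD[of a b] disj ES_S ED_D by auto
    next
      case 4 then show ?thesis using SD[of b a] disj ES_S ED_D by auto
    qed
  qed
  have HE: "H \<subseteq> span E"
  proof
    fix x assume x: "x \<in> H"
    obtain a b where ab: "a \<in> span S" "\<And>z. z \<in> span S \<Longrightarrow> orthogonal b z" "x = a + b"
      using orthogonal_subspace_decomp_exists[of S x] by metis
    have a: "a \<in> S" using ab(1) subS by (metis span_eq_iff)
    have "b = x - a" using ab(3) by simp
    then have "b \<in> H" using x subsetD[OF SH a] subH by (simp add: subspace_diff)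
    then have "b \<in> D" using ab(2) by (simp add: D_def orthogonal_commute span_base)
    then have "b \<in> span E" using ED(3) span_mono[of ED E] by (auto simp: E_def)
    moreover have "a \<in> span E" using a ES(3) span_mono[of ES E] by (auto simp: E_def)
    ultimately show "x \<in> span E" unfolding ab(3) by (intro span_add)
  qed
  have EH: "E \<subseteq> H" using ES_S ED_D SH by (auto simp: E_def D_def)
  have HP: "x \<bullet> z = 0" if "x \<in> H" "z \<in> P" for x z
  proof -
    obtain a b where ab: "x = a + b" "a \<in> S" "b \<in> N" using \<open>x \<in> H\<close> by (auto simp: H_def)
    have "a \<bullet> z = 0" using ab(2) \<open>z \<in> P\<close> by (auto simp: S_def C_def orthogonal_def inner_commute)
    moreover have "orthogonal b z"
    proof (rule orthogonal_to_span)
      show "z \<in> span (dil_pos p ` Q)" using \<open>z \<in> P\<close> by (simp add: P_def)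
      fix k assume "k \<in> dil_pos p ` Q"
      then obtain q where q: "q \<in> Q" "k = dil_pos p q" by auto
      have "orthogonal k b"
        using ab(3) unfolding N_def
        by (rule orthogonal_to_span) (use q oX(3) in \<open>auto simp: orthogonal_def\<close>)
      then show "orthogonal b k" by (simp add: orthogonal_commute)
    qed
    ultimately show ?thesis using ab(1) by (simp add: inner_add_left orthogonal_def)
  qed
  \<comment> \<open>The trace of the dilation of \<open>M\<close> compressed to \<open>H\<close>:
    computed exactly for \<open>X\<close>, bounded below for \<open>X + W\<close> and above for
    \<open>W\<close>.\<close>
  define tr where "tr M = (\<Sum>e\<in>E. 2 * (fst e \<bullet> (M *v snd e)))" for M :: "real^'n^'m"
  have swap: "tr M = (\<Sum>q\<in>Q. s q * ((\<Sum>e\<in>E. (e \<bullet> dil_pos p q)\<^sup>2) - (\<Sum>e\<in>E. (e \<bullet> dil_neg p q)\<^sup>2)))"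
    if "is_svd M Q p s" for M Q p s
    unfolding tr_def dil_form[OF that]
    by (subst sum.swap) (simp only: sum_distrib_left[symmetric] sum_subtractf)
  have trX: "tr X = - (\<Sum>q\<in>Q. s q)"
  proof -
    have "(\<Sum>e\<in>E. (e \<bullet> dil_pos p q)\<^sup>2) - (\<Sum>e\<in>E. (e \<bullet> dil_neg p q)\<^sup>2) = -1" if q: "q \<in> Q" for q
    proof -
      have "dil_pos p q \<in> P" using q by (auto simp: P_def intro: span_base)
      then have "e \<bullet> dil_pos p q = 0" if "e \<in> E" for e
        using HP[OF subsetD[OF EH that]] by blast
      then have "(\<Sum>e\<in>E. (e \<bullet> dil_pos p q)\<^sup>2) = 0" by simp
      moreover have "dil_neg p q \<in> N" using q by (auto simp: N_def intro: span_base)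
      then have "dil_neg p q \<in> span (id ` E)" using HE NH by auto
      from parseval[OF finE oE this] have "(\<Sum>e\<in>E. (e \<bullet> dil_neg p q)\<^sup>2) = 1"
        using oX(2) q by (simp add: inner_commute orthonormal_onD)
      ultimately show ?thesis by simp
    qed
    then show ?thesis by (simp add: swap[OF X] sum_negf)
  qed
  have unit: "(\<Sum>e\<in>A. (e \<bullet> z)\<^sup>2) \<le> 1" if "A \<subseteq> E" "z \<bullet> z = 1" for A z
    using orthonormal_sum_inner_le_1[of A id z] orthonormal_on_subset[OF oE that(1)]
      finite_subset[OF that(1) finE] that(2) by simp
  \<comment> \<open>An orthonormal family sees each negative eigenvector with weight at most one, so
    the trace cannot fall below minus the nuclear norm.\<close>
  have trY: "- (\<Sum>q\<in>V. y q) \<le> tr (X + W)"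
  proof -
    have "- y q \<le> y q * ((\<Sum>e\<in>E. (e \<bullet> dil_pos v q)\<^sup>2) - (\<Sum>e\<in>E. (e \<bullet> dil_neg v q)\<^sup>2))"
      if q: "q \<in> V" for q
    proof -
      have "(\<Sum>e\<in>E. (e \<bullet> dil_neg v q)\<^sup>2) \<le> 1"
        using unit[of E "dil_neg v q"] oY(2) q by (simp add: orthonormal_onD)
      moreover have "0 \<le> (\<Sum>e\<in>E. (e \<bullet> dil_pos v q)\<^sup>2)" by (simp add: sum_nonneg)
      moreover have "y q > 0" using Y q by (simp add: is_svd_def)
      ultimately show ?thesis
        using mult_left_mono[of "-1" "(\<Sum>e\<in>E. (e \<bullet> dil_pos v q)\<^sup>2) - (\<Sum>e\<in>E. (e \<bullet> dil_neg v q)\<^sup>2)" "y q"]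
        by simp
    qed
    then show ?thesis unfolding swap[OF Y] sum_negf[symmetric] by (rule sum_mono)
  qed
  have w: "\<forall>q\<in>R. 0 \<le> w q" using W by (auto simp: is_svd_def less_imp_le)
  \<comment> \<open>How much of each negative eigenvector of \<open>W\<close> lies in
    \<open>S\<close>; \<open>d\<close> measures how much of each positive one lies in
    \<open>D\<close>.\<close>
  define c where "c q = (\<Sum>e\<in>ES. (e \<bullet> dil_neg u q)\<^sup>2)" for q
  define d where "d q = (\<Sum>e\<in>ED. (e \<bullet> dil_pos u q)\<^sup>2)" for q
  have c: "0 \<le> c q" "c q \<le> 1" if "q \<in> R" for q
    using unit[of ES "dil_neg u q"] oW(2) that
    by (auto simp: c_def sum_nonneg E_def orthonormal_onD)
  have d: "0 \<le> d q" "d q \<le> 1" if "q \<in> R" for q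
    using unit[of ED "dil_pos u q"] oW(1) that
    by (auto simp: d_def sum_nonneg E_def orthonormal_onD)
  \<comment> \<open>As \<open>S\<close> lies in \<open>G\<close>, Parseval makes the
    \<open>c q\<close> add up to \<open>dim S\<close>, which falls short of \<open>card R\<close> by
    at most \<open>card Q\<close>.\<close>
  have sum_c: "(\<Sum>q\<in>R. 1 - c q) \<le> real r"
  proof -
    have "(\<Sum>q\<in>R. (e \<bullet> dil_neg u q)\<^sup>2) = 1" if e: "e \<in> ES" for e
    proof -
      have "e \<in> span (dil_neg u ` R)" using e ES_S by (auto simp: S_def G_def)
      from parseval[OF fin(2) oW(2) this] show ?thesis
        using ES(2) e by (simp add: orthonormal_on_def)
    qed
    then have "(\<Sum>q\<in>R. c q) = real (card ES)"
      unfolding c_def by (subst sum.swap) simp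
    then show ?thesis using dimS ES(4) r by (simp add: sum_subtractf)
  qed
  have sum_d: "(\<Sum>q\<in>R. d q) \<le> real r"
  proof -
    have "(\<Sum>q\<in>R. (e \<bullet> dil_pos u q)\<^sup>2) \<le> 1" if e: "e \<in> ED" for e
      using bessel[OF fin(2) oW(1), of e] ED(2) e by (simp add: orthonormal_on_def)
    then have "(\<Sum>e\<in>ED. \<Sum>q\<in>R. (e \<bullet> dil_pos u q)\<^sup>2) \<le> (\<Sum>e\<in>ED. 1)" by (rule sum_mono)
    then have "(\<Sum>q\<in>R. d q) \<le> real (card ED)" unfolding d_def by (subst sum.swap) simp
    then show ?thesis using dimD ED(4) r by simp
  qed
  \<comment> \<open>Positive eigenvectors of \<open>W\<close> are seen only by \<open>ED\<close>;
    what \<open>ED\<close> sees of the negative ones can only lower the trace and is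
    dropped.\<close>
  have trW: "tr W \<le> (\<Sum>q\<in>R. d q * w q) + (\<Sum>q\<in>R. (1 - c q) * w q) - (\<Sum>q\<in>R. w q)"
  proof -
    have "w q * ((\<Sum>e\<in>E. (e \<bullet> dil_pos u q)\<^sup>2) - (\<Sum>e\<in>E. (e \<bullet> dil_neg u q)\<^sup>2))
        \<le> d q * w q + (1 - c q) * w q - w q" if q: "q \<in> R" for q
    proof -
      have "e \<bullet> dil_pos u q = 0" if e: "e \<in> ES" for e
      proof -
        have "e \<in> span (dil_neg u ` R)" using e ES_S by (auto simp: S_def G_def)
        then have "orthogonal (dil_pos u q) e"
          by (rule orthogonal_to_span) (use oW(3) q in \<open>auto simp: orthogonal_def\<close>)
        then show ?thesis by (simp add: orthogonal_def inner_commute)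
      qed
      then have "(\<Sum>e\<in>ES. (e \<bullet> dil_pos u q)\<^sup>2) = 0" by simp
      then have "(\<Sum>e\<in>E. (e \<bullet> dil_pos u q)\<^sup>2) = d q"
        unfolding E_def d_def using ES(1) ED(1) disj by (simp add: sum.union_disjoint)
      moreover have "c q \<le> (\<Sum>e\<in>E. (e \<bullet> dil_neg u q)\<^sup>2)"
        unfolding c_def using finE by (intro sum_mono2) (auto simp: E_def)
      ultimately have "w q * ((\<Sum>e\<in>E. (e \<bullet> dil_pos u q)\<^sup>2) - (\<Sum>e\<in>E. (e \<bullet> dil_neg u q)\<^sup>2))
          \<le> w q * (d q - c q)"
        using w q by (intro mult_left_mono) auto
      then show ?thesis by (simp add: algebra_simps)
    qed
    then have "tr W \<le> (\<Sum>q\<in>R. d q * w q + (1 - c q) * w q - w q)"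
      unfolding swap[OF W] by (rule sum_mono)
    then show ?thesis by (simp only: sum.distrib sum_subtractf)
  qed
  \<comment> \<open>The weights \<open>d\<close> and \<open>1 - c\<close> each cost one sum of top
    entries, hence the factor two in the conclusion.\<close>
  have "(\<Sum>q\<in>R. d q * w q) \<le> (\<Sum>q\<in>T. w q)"
    using weighted_sum_le_top[OF fin(2) T w _ sum_d] d by blast
  moreover have "(\<Sum>q\<in>R. (1 - c q) * w q) \<le> (\<Sum>q\<in>T. w q)"
    using weighted_sum_le_top[OF fin(2) T w _ sum_c] c by auto
  moreover have "tr (X + W) = tr X + tr W"
    by (simp add: tr_def matrix_vector_mult_add_rdistrib inner_add_right sum.distrib algebra_simps)
  ultimately show ?thesis using trX trY trW by linarith
qed

subsection \<open>Concavity of the penalty\<close>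

text \<open>Bounding \<open>|(u \<bullet> p) (v \<bullet> q)|\<close> by the mean of the squares gives doubly substochastic weights.\<close>

lemma svd_pair_weights:
  assumes "is_svd X Q p s" "is_svd Y V v y"
  defines "d \<equiv> \<lambda>i j. ((p i \<bullet> v j)\<^sup>2 + (i \<bullet> j)\<^sup>2) / 2"
  shows "(p i \<bullet> v j) * (i \<bullet> j) \<le> d i j" and "d i j \<ge> 0"
    and "i \<in> Q \<Longrightarrow> (\<Sum>j\<in>V. d i j) \<le> 1" and "j \<in> V \<Longrightarrow> (\<Sum>i\<in>Q. d i j) \<le> 1"
proof -
  show "(p i \<bullet> v j) * (i \<bullet> j) \<le> d i j"
    using sum_squares_bound[of "p i \<bullet> v j" "i \<bullet> j"] by (simp add: d_def)
  show "d i j \<ge> 0" by (simp add: d_def)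
  have X: "finite Q" "orthonormal_on Q id" "orthonormal_on Q p"
    and Y: "finite V" "orthonormal_on V id" "orthonormal_on V v"
    using assms by (auto simp: is_svd_def)
  show "(\<Sum>j\<in>V. d i j) \<le> 1" if i: "i \<in> Q"
  proof -
    have "i \<bullet> i = 1" using X(2) i by (simp add: orthonormal_on_def)
    then show ?thesis
      using bessel[OF Y(1,2), of i] bessel[OF Y(1,3), of "p i"] orthonormal_onD[OF X(3) i i]
      by (simp add: d_def sum_divide_distrib[symmetric] sum.distrib)
  qed
  show "(\<Sum>i\<in>Q. d i j) \<le> 1" if j: "j \<in> V"
  proof -
    have "j \<bullet> j = 1" using Y(2) j by (simp add: orthonormal_on_def)
    then show ?thesis
      using bessel[OF X(1,2), of j] bessel[OF X(1,3), of "v j"] orthonormal_onD[OF Y(3) j j]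
      by (simp add: d_def sum_divide_distrib[symmetric] sum.distrib inner_commute)
  qed
qed

lemma inner_svd_outer_sum:
  assumes "is_svd X Q p s"
  shows "X \<bullet> (\<Sum>j\<in>V. g j *\<^sub>R outer (v j) j) =
    (\<Sum>j\<in>V. \<Sum>i\<in>Q. g j * s i * ((p i \<bullet> v j) * (i \<bullet> j)))"
proof -
  have X: "X = (\<Sum>i\<in>Q. s i *\<^sub>R outer (p i) i)" using assms by (simp add: is_svd_def)
  show ?thesis
    by (subst X)
       (simp add: inner_sum_right inner_sum_left inner_outer_outer sum_distrib_left mult_ac)
qed

text \<open>The slope \<open>g\<close> of the convex function \<open>h\<close> gives a subgradient at \<open>Y\<close>.\<close>

lemma svd_convex_sum_diff:
  fixes h g :: "real \<Rightarrow> real"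
  assumes X: "is_svd X Q p s" and W: "is_svd W R u w" and Y: "is_svd (X + W) V v y"
    and g: "\<And>t. t \<ge> 0 \<Longrightarrow> 0 \<le> g t \<and> g t \<le> a" and h: "\<And>t. t \<ge> 0 \<Longrightarrow> h t \<ge> 0" and "h 0 = 0"
    and tangent: "\<And>t t'. t \<ge> 0 \<Longrightarrow> t' \<ge> 0 \<Longrightarrow> h t' + g t' * (t - t') \<le> h t"
  shows "(\<Sum>q\<in>V. h (y q)) - (\<Sum>q\<in>Q. h (s q)) \<le> a * (\<Sum>q\<in>R. w q)"
proof -
  have pos: "s q > 0" if "q \<in> Q" for q using X that by (simp add: is_svd_def)
  have posw: "w q > 0" if "q \<in> R" for q using W that by (simp add: is_svd_def)
  have posy: "y q > 0" if "q \<in> V" for q using Y that by (simp add: is_svd_def)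
  \<comment> \<open>The subgradient: singular vectors of \<open>X + W\<close>, with slopes in place
    of singular values.\<close>
  define Z where "Z = (\<Sum>j\<in>V. g (y j) *\<^sub>R outer (v j) j)"
  have YZ: "(X + W) \<bullet> Z = (\<Sum>j\<in>V. g (y j) * y j)"
  proof -
    have "(\<Sum>i\<in>V. g (y j) * y i * ((v i \<bullet> v j) * (i \<bullet> j))) = g (y j) * y j" if j: "j \<in> V" for j
    proof -
      have "(\<Sum>i\<in>V. g (y j) * y i * ((v i \<bullet> v j) * (i \<bullet> j)))
          = (\<Sum>i\<in>V. if i = j then g (y j) * y i else 0)"
        using Y j by (intro sum.cong) (auto simp: is_svd_def orthonormal_on_def)
      then show ?thesis using Y j by (simp add: is_svd_def)
    qed
    then show ?thesis unfolding Z_def inner_svd_outer_sum[OF Y] by simp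
  qed
  \<comment> \<open>Duality of the nuclear and spectral norms: the slopes are at most
    \<open>a\<close>, and the row sums of \<open>d\<close> are at most one.\<close>
  have WZ: "W \<bullet> Z \<le> a * (\<Sum>q\<in>R. w q)"
  proof -
    define d where "d i j = ((u i \<bullet> v j)\<^sup>2 + (i \<bullet> j)\<^sup>2) / 2" for i j
    note d = svd_pair_weights[OF W Y, folded d_def]
    have "W \<bullet> Z \<le> (\<Sum>j\<in>V. \<Sum>i\<in>R. a * w i * d i j)"
      unfolding Z_def inner_svd_outer_sum[OF W]
    proof (intro sum_mono)
      fix j i assume "j \<in> V" "i \<in> R"
      then have "g (y j) * w i \<ge> 0" "g (y j) * w i \<le> a * w i"
        using g[of "y j"] posw[of i] posy[of j] by (auto intro: mult_right_mono mult_nonneg_nonneg)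
      then show "g (y j) * w i * ((u i \<bullet> v j) * (i \<bullet> j)) \<le> a * w i * d i j"
        using d(1,2)[of i j] by (meson mult_left_mono mult_right_mono order_trans)
    qed
    also have "\<dots> = (\<Sum>i\<in>R. a * w i * (\<Sum>j\<in>V. d i j))"
      by (subst sum.swap) (simp add: sum_distrib_left)
    also have "\<dots> \<le> (\<Sum>i\<in>R. a * w i * 1)"
      using g[of 0] d(3) posw by (intro sum_mono mult_left_mono) (auto simp: less_imp_le)
    finally show ?thesis by (simp add: sum_distrib_left)
  qed
  \<comment> \<open>Fenchel-Young term by term: \<open>g(y) s\<close> is at most \<open>h(s)\<close>
    plus \<open>g(y) y - h(y)\<close>. Both are nonnegative, so the row sums of \<open>d\<close>
    control the first and the column sums the second.\<close>
  have XZ: "X \<bullet> Z \<le> (\<Sum>q\<in>Q. h (s q)) + (\<Sum>j\<in>V. g (y j) * y j - h (y j))"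
  proof -
    define d where "d i j = ((p i \<bullet> v j)\<^sup>2 + (i \<bullet> j)\<^sup>2) / 2" for i j
    note d = svd_pair_weights[OF X Y, folded d_def]
    have "X \<bullet> Z \<le> (\<Sum>j\<in>V. \<Sum>i\<in>Q. h (s i) * d i j + (g (y j) * y j - h (y j)) * d i j)"
      unfolding Z_def inner_svd_outer_sum[OF X]
    proof (intro sum_mono)
      fix j i assume ij: "j \<in> V" "i \<in> Q"
      then have "g (y j) * s i \<ge> 0"
        using g[of "y j"] pos[of i] posy[of j] by (auto intro: mult_nonneg_nonneg)
      then have "g (y j) * s i * ((p i \<bullet> v j) * (i \<bullet> j)) \<le> g (y j) * s i * d i j"
        using d(1) by (rule mult_left_mono[rotated])
      also have "\<dots> \<le> (h (s i) + (g (y j) * y j - h (y j))) * d i j"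
        using tangent[of "s i" "y j"] ij pos posy d(2)
        by (intro mult_right_mono) (auto simp: less_imp_le algebra_simps)
      finally show "g (y j) * s i * ((p i \<bullet> v j) * (i \<bullet> j))
          \<le> h (s i) * d i j + (g (y j) * y j - h (y j)) * d i j"
        by (simp add: algebra_simps)
    qed
    also have "\<dots> = (\<Sum>j\<in>V. \<Sum>i\<in>Q. h (s i) * d i j)
        + (\<Sum>j\<in>V. \<Sum>i\<in>Q. (g (y j) * y j - h (y j)) * d i j)"
      by (simp only: sum.distrib)
    also have "(\<Sum>j\<in>V. \<Sum>i\<in>Q. h (s i) * d i j) = (\<Sum>i\<in>Q. h (s i) * (\<Sum>j\<in>V. d i j))"
      by (subst sum.swap) (simp add: sum_distrib_left)
    also have "\<dots> \<le> (\<Sum>i\<in>Q. h (s i) * 1)"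
      using d(3) h pos by (intro sum_mono mult_left_mono) (auto simp: less_imp_le)
    also have "(\<Sum>j\<in>V. \<Sum>i\<in>Q. (g (y j) * y j - h (y j)) * d i j)
        = (\<Sum>j\<in>V. (g (y j) * y j - h (y j)) * (\<Sum>i\<in>Q. d i j))"
      by (simp add: sum_distrib_left)
    also have "\<dots> \<le> (\<Sum>j\<in>V. (g (y j) * y j - h (y j)) * 1)"
    proof (intro sum_mono mult_left_mono)
      fix j assume j: "j \<in> V"
      then show "(\<Sum>i\<in>Q. d i j) \<le> 1" by (rule d(4))
      show "0 \<le> g (y j) * y j - h (y j)"
        using tangent[of 0 "y j"] \<open>h 0 = 0\<close> posy[OF j] by simp
    qed
    finally show ?thesis by simp
  qed
  show ?thesis
    using YZ WZ XZ by (simp add: inner_add_left sum_subtractf)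
qed

lemma frac_fun_excess:
  assumes "a > 0" "t \<ge> 0"
  shows "a * t - frac_fun a t = a\<^sup>2 * t\<^sup>2 / (1 + a * t)"
proof -
  have "1 + a * t > 0" using assms by (simp add: add_pos_nonneg)
  then show ?thesis
    using assms by (simp add: frac_fun_def field_simps power2_eq_square)
qed

text \<open>With \<open>A = 1 + a t\<close> and \<open>B = 1 + a t'\<close> the function is
  \<open>1 - 1 / A\<close>, and its gap to the tangent at \<open>t'\<close> is
  \<open>(A - B)^2 / (A B^2)\<close>.\<close>

lemma frac_fun_tangent:
  assumes "a > 0" "t \<ge> 0" "t' \<ge> 0"
  shows "frac_fun a t \<le> frac_fun a t' + a / (1 + a * t')\<^sup>2 * (t - t')"
proof -
  let ?A = "1 + a * t" and ?B = "1 + a * t'"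
  have AB: "?A > 0" "?B > 0" using assms by (simp_all add: add_pos_nonneg)
  have "frac_fun a t' + a / ?B\<^sup>2 * (t - t') - frac_fun a t = a\<^sup>2 * (t - t')\<^sup>2 / (?A * ?B\<^sup>2)"
  proof -
    have f: "frac_fun a x = 1 - 1 / (1 + a * x)" if "x \<ge> 0" "1 + a * x > 0" for x
      using that assms by (simp add: frac_fun_def field_simps)
    have eq: "a / ?B\<^sup>2 * (t - t') = (?A - ?B) / ?B\<^sup>2" "a\<^sup>2 * (t - t')\<^sup>2 = (?A - ?B)\<^sup>2"
      by (simp_all add: power_mult_distrib[symmetric] algebra_simps)
    have "1 - 1 / B + (A - B) / B\<^sup>2 - (1 - 1 / A) = (A - B)\<^sup>2 / (A * B\<^sup>2)"
      if "A > 0" "B > 0" for A B :: real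
      using that by (simp add: field_simps power2_eq_square)
    from this[OF AB] show ?thesis
      unfolding f[OF assms(2) AB(1)] f[OF assms(3) AB(2)] eq .
  qed
  moreover have "\<dots> \<ge> 0" using AB by (intro divide_nonneg_nonneg mult_nonneg_nonneg) auto
  ultimately show ?thesis by linarith
qed

text \<open>Applies the convex estimate to \<open>h(t) = a t - frac_fun a t\<close>, whose
  derivative \<open>a - a / (1 + a t)^2\<close> is taken as the slope.\<close>

lemma frac_penalty_perturbation:
  assumes X: "is_svd X Q p s" and W: "is_svd W R u w" and Y: "is_svd (X + W) V v y" and a: "a > 0"
  shows "(\<Sum>q\<in>V. a * y q - frac_fun a (y q)) - (\<Sum>q\<in>Q. a * s q - frac_fun a (s q))
    \<le> a * (\<Sum>q\<in>R. w q)"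
proof (rule svd_convex_sum_diff[OF X W Y, where g = "\<lambda>t. a - a / (1 + a * t)\<^sup>2"])
  fix t :: real assume t: "t \<ge> 0"
  have "(1 + a * t)\<^sup>2 \<ge> 1" using a t by (intro one_le_power) simp
  then have "a / (1 + a * t)\<^sup>2 \<le> a / 1" using a by (intro divide_left_mono) auto
  then show "0 \<le> a - a / (1 + a * t)\<^sup>2 \<and> a - a / (1 + a * t)\<^sup>2 \<le> a" using a by simp
  show "0 \<le> a * t - frac_fun a t" using a t by (simp add: frac_fun_excess)
  fix t' :: real assume "t' \<ge> 0"
  from frac_fun_tangent[OF a t this]
  show "a * t' - frac_fun a t' + (a - a / (1 + a * t')\<^sup>2) * (t - t') \<le> a * t - frac_fun a t"
    by (simp add: algebra_simps)
qed (simp add: frac_fun_def)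

subsection \<open>Null space property from restricted isometry\<close>

text \<open>Polarization: \<open>4 \<mu>\<close> times the inner product is the difference of the
  squared norms of the images of \<open>X + \<mu> Z\<close> and \<open>X - \<mu> Z\<close>, which by
  orthogonality have equal norms themselves.\<close>

lemma rip_inner_le:
  assumes A: "linear \<A>" and rip: "rip_bound \<A> k \<delta>"
    and rank: "rank (X + \<mu> *\<^sub>R Z) \<le> k" "rank (X - \<mu> *\<^sub>R Z) \<le> k" and orth: "X \<bullet> Z = 0"
  shows "2 * \<mu> * (\<A> X \<bullet> \<A> Z) \<le> \<delta> * ((norm X)\<^sup>2 + \<mu>\<^sup>2 * (norm Z)\<^sup>2)"
proof -
  have norms: "(norm (X + \<mu> *\<^sub>R Z))\<^sup>2 = (norm X)\<^sup>2 + \<mu>\<^sup>2 * (norm Z)\<^sup>2"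
    "(norm (X - \<mu> *\<^sub>R Z))\<^sup>2 = (norm X)\<^sup>2 + \<mu>\<^sup>2 * (norm Z)\<^sup>2"
    using orth norm_add_Pythagorean[of X "\<mu> *\<^sub>R Z"] norm_add_Pythagorean[of X "- (\<mu> *\<^sub>R Z)"]
    by (simp_all add: orthogonal_def power_mult_distrib)
  have "(norm (\<A> (X + \<mu> *\<^sub>R Z)))\<^sup>2 \<le> (1 + \<delta>) * ((norm X)\<^sup>2 + \<mu>\<^sup>2 * (norm Z)\<^sup>2)"
    "(1 - \<delta>) * ((norm X)\<^sup>2 + \<mu>\<^sup>2 * (norm Z)\<^sup>2) \<le> (norm (\<A> (X - \<mu> *\<^sub>R Z)))\<^sup>2"
    using rip rank norms unfolding rip_bound_def by metis+
  moreover have "(norm (\<A> (X + \<mu> *\<^sub>R Z)))\<^sup>2 - (norm (\<A> (X - \<mu> *\<^sub>R Z)))\<^sup>2 = 4 * \<mu> * (\<A> X \<bullet> \<A> Z)"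
    by (simp add: power2_norm_eq_inner linear_add[OF A] linear_diff[OF A] linear_scale[OF A]
        inner_add_left inner_add_right inner_diff_left inner_diff_right inner_commute algebra_simps)
  ultimately show ?thesis by (simp add: algebra_simps)
qed

lemma sum_square_le_card_mult:
  fixes f :: "'i \<Rightarrow> real"
  assumes "card I \<le> r"
  shows "(\<Sum>i\<in>I. f i)\<^sup>2 \<le> r * (\<Sum>i\<in>I. (f i)\<^sup>2)"
proof -
  have "(\<Sum>i\<in>I. f i)\<^sup>2 \<le> (\<Sum>i\<in>I. (f i)\<^sup>2) * (\<Sum>i\<in>I. 1\<^sup>2)"
    using Cauchy_Schwarz_ineq_sum[of f "\<lambda>_. 1" I] by simp
  also have "\<dots> \<le> r * (\<Sum>i\<in>I. (f i)\<^sup>2)"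
    using assms by (simp add: mult.commute mult_right_mono sum_nonneg)
  finally show ?thesis .
qed

text \<open>As \<A> kills \<open>W\<close>, the image of the head \<open>X\<close> is minus that of
  the tail. The squared norm of this image is at least \<open>(1 - \<delta>) |X|^2\<close> by
  restricted isometry and at most \<open>\<tau> \<delta> |X|^2\<close> by the tail bound, against
  \<open>small\<close>.\<close>

lemma kernel_head_bound:
  assumes A: "linear \<A>" and rip: "rip_bound \<A> (2 * r) \<delta>" and ker: "\<A> W = 0" and r: "r > 0"
    and W: "is_svd W R u w" and T: "is_top r w R T" and tau: "\<tau> \<ge> 1"
    and tail: "(\<Sum>q\<in>R - T. w q) \<le> \<tau> * (\<Sum>q\<in>T. w q)" and small: "\<delta> * (1 + \<tau>) < 1"
  shows "W = 0"
proof (rule ccontr)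
  assume "W \<noteq> 0"
  have R: "finite R" "orthonormal_on R id" "orthonormal_on R u" "\<And>q. q \<in> R \<Longrightarrow> w q > 0"
    and Weq: "W = (\<Sum>q\<in>R. w q *\<^sub>R outer (u q) q)"
    using W by (auto simp: is_svd_def)
  have TR: "T \<subseteq> R" "card T \<le> r" using T by (auto simp: is_top_def)
  have finT: "finite T" using TR R(1) finite_subset by blast
  have "R \<noteq> {}" using Weq \<open>W \<noteq> 0\<close> by auto
  then have "card T \<noteq> 0" using T r R(1) by (auto simp: is_top_def)
  then have "T \<noteq> {}" by auto
  define K where "K = (\<Sum>q\<in>T. w q)"
  have K: "K > 0"
    unfolding K_def using finT \<open>T \<noteq> {}\<close> R(4) TR by (intro sum_pos) auto
  have inner_O: "outer (u i) i \<bullet> outer (u j) j = (if i = j then 1 else 0)"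
    if "i \<in> R" "j \<in> R" for i j
    using R that by (auto simp: inner_outer_outer orthonormal_on_def)
  have inner_sums: "(\<Sum>i\<in>I. c i *\<^sub>R outer (u i) i) \<bullet> (\<Sum>j\<in>J. e j *\<^sub>R outer (u j) j)
      = (\<Sum>j\<in>J. if j \<in> I then e j * c j else 0)" if "I \<subseteq> R" "J \<subseteq> R" for I J c e
  proof -
    have o: "orthonormal_on R (\<lambda>i. outer (u i) i)" using inner_O by (simp add: orthonormal_on_def)
    show ?thesis
      unfolding inner_sum_right inner_scaleR_right
      by (intro sum.cong) (use inner_sum_orthonormal[OF R(1) o that(1)] that(2) in auto)
  qed
  define X where "X = (\<Sum>q\<in>T. w q *\<^sub>R outer (u q) q)"
  have normX: "(norm X)\<^sup>2 = (\<Sum>q\<in>T. (w q)\<^sup>2)"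
    using inner_sums[OF TR(1) TR(1), of w w]
    unfolding X_def power2_norm_eq_inner by (simp add: power2_eq_square)
  have KX: "K\<^sup>2 \<le> r * (norm X)\<^sup>2"
    unfolding normX K_def using TR(2) by (rule sum_square_le_card_mult)
  then have "norm X \<noteq> 0" using K by (auto simp: power2_eq_square mult_le_0_iff)
  then have nX: "norm X > 0" by simp
  have KX': "K \<le> sqrt r * norm X"
    using KX by (metis norm_ge_zero of_nat_0_le_iff power2_le_imp_le mult_nonneg_nonneg
        power_mult_distrib real_sqrt_ge_0_iff real_sqrt_pow2)
  define g where "g q = \<A> X \<bullet> \<A> (outer (u q) q)" for q
  have \<delta>: "\<delta> \<ge> 0" using rip by (simp add: rip_bound_def)
  \<comment> \<open>The sign matrix \<open>Z\<close>, of rank at most \<open>r\<close> and Frobenius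
    norm at most \<open>sqrt r\<close>, turns one inner product into the sum of absolute
    values.\<close>
  have head: "(\<Sum>q\<in>I. \<bar>g q\<bar>) \<le> \<delta> * norm X * sqrt r" if I: "I \<subseteq> R - T" "card I \<le> r" for I
  proof -
    have finI: "finite I" using I(1) R(1) finite_subset by blast
    have IR: "I \<subseteq> R" and disj: "T \<inter> I = {}" using I by auto
    define Z where "Z = (\<Sum>q\<in>I. sgn (g q) *\<^sub>R outer (u q) q)"
    have gZ: "\<A> X \<bullet> \<A> Z = (\<Sum>q\<in>I. \<bar>g q\<bar>)"
      by (simp add: Z_def g_def linear_sum[OF A] linear_scale[OF A] inner_sum_right abs_sgn mult.commute)
    have "(norm Z)\<^sup>2 = (\<Sum>q\<in>I. (sgn (g q))\<^sup>2)"
      using inner_sums[OF IR IR, of "\<lambda>q. sgn (g q)" "\<lambda>q. sgn (g q)"]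
      unfolding Z_def power2_norm_eq_inner by (simp add: power2_eq_square)
    also have "\<dots> \<le> (\<Sum>q\<in>I. 1)" by (intro sum_mono) (simp add: sgn_if)
    also have "\<dots> \<le> r" using I(2) by simp
    finally have normZ: "(norm Z)\<^sup>2 \<le> r" .
    have orth: "X \<bullet> Z = 0"
      using inner_sums[OF TR(1) IR, of w "\<lambda>q. sgn (g q)"] disj
      by (auto simp: X_def Z_def intro!: sum.neutral)
    have rank: "rank (X + c *\<^sub>R Z) \<le> 2 * r" for c
    proof -
      have "X + c *\<^sub>R Z = (\<Sum>q\<in>T \<union> I. (if q \<in> T then w q else c * sgn (g q)) *\<^sub>R outer (u q) q)"
        unfolding sum.union_disjoint[OF finT finI disj] X_def Z_def scaleR_sum_right scaleR_scaleR
        by (intro arg_cong2[of _ _ _ _ "(+)"] sum.cong) (use disj in auto)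
      then have "rank (X + c *\<^sub>R Z) \<le> card (T \<union> I)"
        using rank_sum_outer_le[of "T \<union> I"] finT finI by simp
      also have "\<dots> \<le> 2 * r" using card_Un_le[of T I] TR(2) I(2) by simp
      finally show ?thesis .
    qed
    \<comment> \<open>Balances \<open>|X|^2\<close> against \<open>\<mu>^2 r\<close>, which
      minimizes the bound after division by \<open>2 \<mu>\<close>.\<close>
    define \<mu> where "\<mu> = norm X / sqrt r"
    have \<mu>: "\<mu> > 0" "\<mu>\<^sup>2 * r = (norm X)\<^sup>2" "\<mu> * sqrt r = norm X"
      using nX r by (simp_all add: \<mu>_def power_divide)
    have "2 * \<mu> * (\<A> X \<bullet> \<A> Z) \<le> \<delta> * ((norm X)\<^sup>2 + \<mu>\<^sup>2 * (norm Z)\<^sup>2)"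
      using rip_inner_le[OF A rip rank[of \<mu>] _ orth] rank[of "- \<mu>"] by simp
    also have "\<dots> \<le> \<delta> * ((norm X)\<^sup>2 + \<mu>\<^sup>2 * r)"
      using \<delta> normZ by (intro mult_left_mono add_left_mono) auto
    also have "\<dots> = 2 * \<mu> * (\<delta> * norm X * sqrt r)"
      unfolding \<mu>(2) using \<mu>(3) by (simp add: power2_eq_square algebra_simps)
    finally show ?thesis using \<mu>(1) gZ by simp
  qed
  define \<theta> where "\<theta> = \<tau> * K / r"
  have \<theta>: "\<theta> > 0" using K tau r by (simp add: \<theta>_def)
  \<comment> \<open>A positive tail entry forces a positive threshold \<open>m\<close>, so
    \<open>T\<close> has \<open>r\<close> entries, all at least \<open>m\<close>; hence
    \<open>r * m \<le> K\<close>.\<close>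
  have wle: "w q \<le> \<theta>" if q: "q \<in> R - T" for q
  proof -
    have "\<forall>q\<in>R. 0 \<le> w q" using R(4) by (simp add: less_imp_le)
    then obtain m where m: "0 \<le> m" "\<forall>q\<in>T. m \<le> w q" "\<forall>q\<in>R - T. w q \<le> m" "m = 0 \<or> card T = r"
      using top_threshold[OF R(1) T] by blast
    have "w q \<le> m" "w q > 0" using m(3) q R(4) by auto
    then have "card T = r" using m(4) by auto
    then have "r * m \<le> K" using sum_bounded_below[of T m w] m(2) by (simp add: K_def)
    then have "m \<le> K / r" using r by (simp add: field_simps)
    also have "\<dots> \<le> \<theta>" using K tau r by (simp add: \<theta>_def divide_right_mono)
    finally show ?thesis using \<open>w q \<le> m\<close> by simp
  qed
  \<comment> \<open>The extremal tail has the constant value \<theta> on the \<open>r\<close>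
    indices of largest correlation; \<open>w q / \<theta>\<close> are admissible weights with total
    at most \<open>r\<close>.\<close>
  obtain I where I: "is_top r (\<lambda>q. \<bar>g q\<bar>) (R - T) I" using ex_is_top R(1) by blast
  have "(\<Sum>q\<in>R - T. w q / \<theta> * \<bar>g q\<bar>) \<le> (\<Sum>q\<in>I. \<bar>g q\<bar>)"
  proof (rule weighted_sum_le_top[OF _ I])
    show "\<forall>q\<in>R - T. 0 \<le> w q / \<theta> \<and> w q / \<theta> \<le> 1"
      using wle \<theta> R(4) by (auto simp: less_imp_le)
    have "(\<Sum>q\<in>R - T. w q) \<le> \<theta> * r" using tail r by (simp add: \<theta>_def K_def)
    then show "(\<Sum>q\<in>R - T. w q / \<theta>) \<le> real r"
      using \<theta> by (simp add: sum_divide_distrib[symmetric] divide_le_eq mult.commute)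
  qed (use R(1) in auto)
  also have "\<dots> \<le> \<delta> * norm X * sqrt r"
    using I by (intro head) (auto simp: is_top_def)
  finally have "\<theta> * (\<Sum>q\<in>R - T. w q / \<theta> * \<bar>g q\<bar>) \<le> \<theta> * (\<delta> * norm X * sqrt r)"
    using \<theta> by (intro mult_left_mono) auto
  then have tail_g: "(\<Sum>q\<in>R - T. w q * \<bar>g q\<bar>) \<le> \<theta> * (\<delta> * norm X * sqrt r)"
    using \<theta> by (simp add: sum_distrib_left)
  have "W = X + (\<Sum>q\<in>R - T. w q *\<^sub>R outer (u q) q)"
    unfolding Weq X_def using sum.subset_diff[OF TR(1) R(1)] by (simp add: add.commute)
  then have "0 = \<A> X + (\<Sum>q\<in>R - T. w q *\<^sub>R \<A> (outer (u q) q))"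
    using ker by (simp add: linear_add[OF A] linear_sum[OF A] linear_scale[OF A])
  from arg_cong[OF this, of "\<lambda>z. \<A> X \<bullet> z"]
  have "(norm (\<A> X))\<^sup>2 = - (\<Sum>q\<in>R - T. w q * g q)"
    by (simp add: inner_add_right inner_sum_right g_def power2_norm_eq_inner)
  also have "\<dots> \<le> (\<Sum>q\<in>R - T. w q * \<bar>g q\<bar>)"
    unfolding sum_negf[symmetric] mult_minus_right[symmetric]
    using R(4) by (intro sum_mono mult_left_mono) (auto intro: less_imp_le)
  also note tail_g
  \<comment> \<open>Here \<open>r\<close> cancels: Cauchy-Schwarz on the head gives
    \<open>K / sqrt r \<le> norm X\<close>.\<close>
  also have "\<theta> * (\<delta> * norm X * sqrt r) = \<tau> * \<delta> * norm X * (K / sqrt r)"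
    using r by (simp add: \<theta>_def field_simps)
  also have "\<dots> \<le> \<tau> * \<delta> * norm X * norm X"
    using KX' r tau \<delta> by (intro mult_left_mono) (auto simp: divide_le_eq mult.commute)
  finally have upper: "(norm (\<A> X))\<^sup>2 \<le> \<tau> * \<delta> * (norm X)\<^sup>2" by (simp add: power2_eq_square mult.assoc)
  have "rank X \<le> 2 * r"
    using rank_sum_outer_le[OF finT, of w u id] TR(2) by (simp add: X_def)
  then have "(1 - \<delta>) * (norm X)\<^sup>2 \<le> (norm (\<A> X))\<^sup>2"
    using rip by (simp add: rip_bound_def)
  with upper have "(1 - \<delta>) * (norm X)\<^sup>2 \<le> (\<tau> * \<delta>) * (norm X)\<^sup>2" by simp
  then have "1 - \<delta> \<le> \<tau> * \<delta>" using nX by (simp add: mult_le_cancel_right)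
  then show False using small by (simp add: algebra_simps)
qed

section \<open>Exact recovery from the two perturbation bounds\<close>

theorem theorem3p6:
  fixes \<alpha> \<beta> :: real
    and \<A> :: "real^'n2^'n1 \<Rightarrow> real^'n3"
    and r :: nat
    and X0 :: "real^'n2^'n1"
    and b :: "real^'n3"
  assumes "\<alpha> > 0" and "\<beta> > 0" and "\<beta> \<le> 1 / (20 * \<alpha>)"
    and "linear \<A>"
    and "r > 0"
    and "rank X0 \<le> r"
    and "rip_const \<A> (2 * r) \<le> 0.4663"
    and "b = \<A> X0"
  shows "\<forall>X. is_arg_min (\<lambda>X. nuclear_norm X + \<beta> * frac_penalty \<alpha> X) (\<lambda>X. \<A> X = b) X
           \<longleftrightarrow> X = X0"
proof -
  let ?F = "\<lambda>X. nuclear_norm X + \<beta> * frac_penalty \<alpha> X"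
  have strict: "?F X0 < ?F X" if "\<A> X = b" "X \<noteq> X0" for X
  proof (rule ccontr)
    assume "\<not> ?F X0 < ?F X"
    then have le: "?F X \<le> ?F X0" by simp
    define W where "W = X - X0"
    have X: "X = X0 + W" by (simp add: W_def)
    have ker: "\<A> W = 0" using that assms(8) by (simp add: W_def linear_diff[OF assms(4)])
    obtain Q p s where Q: "is_svd X0 Q p s" and QF: "\<And>g::real \<Rightarrow> real. g 0 = 0 \<Longrightarrow>
        (\<Sum>i=1..min_dim X0. g (singular_value X0 i)) = (\<Sum>q\<in>Q. g (s q))"
      using ex_svd[of X0] by blast
    obtain V v y where V: "is_svd (X0 + W) V v y" and VF: "\<And>g::real \<Rightarrow> real. g 0 = 0 \<Longrightarrow>
        (\<Sum>i=1..min_dim X. g (singular_value X i)) = (\<Sum>q\<in>V. g (y q))"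
      using ex_svd[of "X0 + W"] unfolding X[symmetric] by blast
    obtain R u w where R: "is_svd W R u w" using ex_svd[of W] by blast
    have "finite R" using R by (simp add: is_svd_def)
    then obtain T where T: "is_top r w R T" using ex_is_top by blast
    define K where "K = (\<Sum>q\<in>T. w q)"
    define k where "k = \<alpha> * \<beta>"
    have k: "k > 0" "k \<le> 1 / 20"
      using assms(1-3) by (simp_all add: k_def field_simps)
    have TR: "T \<subseteq> R" using T by (simp add: is_top_def)
    have wpos: "\<And>q. q \<in> R \<Longrightarrow> w q > 0" using R by (simp add: is_svd_def)
    have K: "K \<ge> 0" unfolding K_def using wpos TR by (intro sum_nonneg) (auto simp: less_imp_le)
    have "(\<Sum>q\<in>Q. s q) + (\<Sum>q\<in>R. w q) - 2 * K \<le> (\<Sum>q\<in>V. y q)"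
      unfolding K_def
      using card_le_rank_svd[OF Q] assms(6) by (intro nuclear_norm_perturbation[OF Q R V _ T]) simp
    \<comment> \<open>The objective is \<open>1 + k\<close> times the nuclear norm minus \<beta>
      times the spectral sum of \<open>h\<close>; this fixes the factors of the two perturbation
      bounds.\<close>
    then have A: "(1 + k) * ((\<Sum>q\<in>R. w q) - 2 * K) \<le> (1 + k) * ((\<Sum>q\<in>V. y q) - (\<Sum>q\<in>Q. s q))"
      using k by (intro mult_left_mono) auto
    have "\<beta> * ((\<Sum>q\<in>V. \<alpha> * y q - frac_fun \<alpha> (y q)) - (\<Sum>q\<in>Q. \<alpha> * s q - frac_fun \<alpha> (s q)))
        \<le> \<beta> * (\<alpha> * (\<Sum>q\<in>R. w q))"
      using frac_penalty_perturbation[OF Q R V assms(1)] assms(2) by (intro mult_left_mono) auto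
    then have B: "k * (\<Sum>q\<in>V. y q) - \<beta> * (\<Sum>q\<in>V. frac_fun \<alpha> (y q)) - k * (\<Sum>q\<in>Q. s q)
        + \<beta> * (\<Sum>q\<in>Q. frac_fun \<alpha> (s q)) \<le> k * (\<Sum>q\<in>R. w q)"
      by (simp add: sum_subtractf sum_distrib_left[symmetric] k_def algebra_simps)
    have "(\<Sum>q\<in>V. y q) + \<beta> * (\<Sum>q\<in>V. frac_fun \<alpha> (y q))
        \<le> (\<Sum>q\<in>Q. s q) + \<beta> * (\<Sum>q\<in>Q. frac_fun \<alpha> (s q))"
      using le QF[of "\<lambda>t. t"] VF[of "\<lambda>t. t"] QF[of "frac_fun \<alpha>"] VF[of "frac_fun \<alpha>"]
      by (simp add: nuclear_norm_def frac_penalty_def frac_fun_def)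
    with A B have "(\<Sum>q\<in>R. w q) \<le> 2 * (1 + k) * K" by (simp add: algebra_simps)
    moreover have "k * K \<le> 1 / 20 * K" using k K by (intro mult_right_mono) auto
    ultimately have "(\<Sum>q\<in>R. w q) \<le> 2.1 * K" by (simp add: algebra_simps)
    moreover have "(\<Sum>q\<in>R. w q) = (\<Sum>q\<in>R - T. w q) + K"
      unfolding K_def using sum.subset_diff[OF TR \<open>finite R\<close>] .
    \<comment> \<open>\<open>1.1\<close> is \<open>1 + 2 k\<close> at the extreme value
      \<open>k = 1 / 20\<close>.\<close>
    ultimately have tail: "(\<Sum>q\<in>R - T. w q) \<le> 1.1 * K" by simp
    \<comment> \<open>The smallness condition holds since
      \<open>0.4663 * 2.1 = 0.97923\<close>.\<close>
    have "W = 0"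
      using kernel_head_bound[OF assms(4) rip_bound_rip_const[OF assms(4)] ker assms(5) R T, of "1.1"]
        tail assms(7) by (simp add: K_def)
    then show False using that(2) by (simp add: W_def)
  qed
  show ?thesis
  proof (intro allI iffI)
    fix X assume "is_arg_min ?F (\<lambda>X. \<A> X = b) X"
    then show "X = X0" using strict[of X] assms(8) by (auto simp: is_arg_min_def)
  next
    fix X assume "X = X0"
    then show "is_arg_min ?F (\<lambda>X. \<A> X = b) X"
      using strict assms(8) by (force simp: is_arg_min_def)
  qed
qed

end
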